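(* Let $(R,P)$ be a Rota-Baxter algebra of weight $\lambda$ over a unitary commutative ring $\mathbf{k}$. Then there is an isomorphism of $\mathbf{k}$-algebras $$U_{RB}(R)\cong R\oplus(R\otimes R).$$
   Context: Algebras are unitary associative over $\mathbf{k}$ and $\otimes=\otimes_{\mathbf{k}}$. A Rota-Baxter algebra of weight $\lambda\in\mathbf{k}$ is a pair $(R,P)$ with $R$ a $\mathbf{k}$-algebra and $P:R\to R$ $\mathbf{k}$-linear with $P(x)P(y)=P(xP(y))+P(P(x)y)+\lambda P(xy)$ for all $x,y\in R$. Put $\tilde P=-\lambda\,\mathrm{id}_R-P$. The ring of Rota-Baxter operators $U_{RB}(R)=U_{RB}(R,P)$ is the quotient of the free product (coproduct of unitary associative $\mathbf{k}$-algebras) $\mathbf{k}\langle R,\mathbf{k}[Q]\rangle$ of $R$ and the polynomial algebra $\mathbf{k}[Q]$ by the two-sided ideal generated by the elements $QrQ-P(r)Q+QP(r)+\lambda Qr$ for $r\in R$. The $\mathbf{k}$-module $R\oplus(R\otimes R)$ is given the associative algebra structure that on $R$ is the multiplication of $R$, with $r\cdot(r_1\otimes s_1)=rr_1\otimes s_1$ and $(r_1\otimes s_1)\cdot s=r_1\otimes s_1s$, and on $R\otimes R$ is $$(r_1\otimes s_1)\cdot(r_2\otimes s_2)=r_1P(s_1r_2)\otimes s_2+r_1\otimes\tilde P(s_1r_2)s_2 .$$ *)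

theory Defs
  imports "HOL-Algebra.QuotRing" "HOL-Algebra.UnivPoly"
begin

section \<open>Associative unitary algebras over a commutative ring\<close>

text \<open>The library locale \<^locale>\<open>algebra\<close> is restricted to commutative algebras, so the
  noncommutative version is introduced here.\<close>

locale assoc_algebra = module K A + ring A
  for K :: "('k, 'u) ring_scheme" (structure) and A :: "('k, 'a, 'v) module_scheme" (structure) +
  assumes smult_mult_left:
      "\<lbrakk>c \<in> carrier K; x \<in> carrier A; y \<in> carrier A\<rbrakk>
        \<Longrightarrow> (c \<odot>\<^bsub>A\<^esub> x) \<otimes>\<^bsub>A\<^esub> y = c \<odot>\<^bsub>A\<^esub> (x \<otimes>\<^bsub>A\<^esub> y)"
    and smult_mult_right:
      "\<lbrakk>c \<in> carrier K; x \<in> carrier A; y \<in> carrier A\<rbrakk>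
        \<Longrightarrow> x \<otimes>\<^bsub>A\<^esub> (c \<odot>\<^bsub>A\<^esub> y) = c \<odot>\<^bsub>A\<^esub> (x \<otimes>\<^bsub>A\<^esub> y)"

definition algebra_iso ::
  "('k, 'u) ring_scheme \<Rightarrow> ('k, 'a, 'v) module_scheme \<Rightarrow> ('k, 'b, 'w) module_scheme \<Rightarrow> ('a \<Rightarrow> 'b) set"
  where "algebra_iso K A B =
    {h \<in> ring_iso A B. \<forall>c\<in>carrier K. \<forall>x\<in>carrier A. h (c \<odot>\<^bsub>A\<^esub> x) = c \<odot>\<^bsub>B\<^esub> h x}"

definition algebras_isomorphic ::
  "('k, 'u) ring_scheme \<Rightarrow> ('k, 'a, 'v) module_scheme \<Rightarrow> ('k, 'b, 'w) module_scheme \<Rightarrow> bool"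
  where "algebras_isomorphic K A B \<longleftrightarrow>
    assoc_algebra K A \<and> assoc_algebra K B \<and> (\<exists>h. h \<in> algebra_iso K A B)"

locale rota_baxter_algebra = assoc_algebra K R
  for K :: "('k, 'u) ring_scheme" (structure) and R :: "('k, 'r, 'v) module_scheme" (structure) +
  fixes P :: "'r \<Rightarrow> 'r" and lam :: 'k
  assumes weight_closed: "lam \<in> carrier K"
    and P_closed: "x \<in> carrier R \<Longrightarrow> P x \<in> carrier R"
    and P_add: "\<lbrakk>x \<in> carrier R; y \<in> carrier R\<rbrakk> \<Longrightarrow> P (x \<oplus>\<^bsub>R\<^esub> y) = P x \<oplus>\<^bsub>R\<^esub> P y"
    and P_smult: "\<lbrakk>c \<in> carrier K; x \<in> carrier R\<rbrakk> \<Longrightarrow> P (c \<odot>\<^bsub>R\<^esub> x) = c \<odot>\<^bsub>R\<^esub> P x"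
    and rota_baxter: "\<lbrakk>x \<in> carrier R; y \<in> carrier R\<rbrakk> \<Longrightarrow>
      P x \<otimes>\<^bsub>R\<^esub> P y =
        P (x \<otimes>\<^bsub>R\<^esub> P y) \<oplus>\<^bsub>R\<^esub> P (P x \<otimes>\<^bsub>R\<^esub> y) \<oplus>\<^bsub>R\<^esub> lam \<odot>\<^bsub>R\<^esub> P (x \<otimes>\<^bsub>R\<^esub> y)"

section \<open>Free modules, free algebras and quotients\<close>

definition finsupp :: "('k, 'u) ring_scheme \<Rightarrow> 'x set \<Rightarrow> ('x \<Rightarrow> 'k) set"
  where "finsupp K X = {f. (\<forall>x. f x \<in> carrier K) \<and> finite {x. f x \<noteq> \<zero>\<^bsub>K\<^esub>} \<and> {x. f x \<noteq> \<zero>\<^bsub>K\<^esub>} \<subseteq> X}"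

definition basis_vec :: "('k, 'u) ring_scheme \<Rightarrow> 'x \<Rightarrow> 'x \<Rightarrow> 'k"
  where "basis_vec K x = (\<lambda>y. if y = x then \<one>\<^bsub>K\<^esub> else \<zero>\<^bsub>K\<^esub>)"

text \<open>Modules are represented by the record type of the library, which also has fields for a
  multiplication and a unit; these carry no information for a mere module.\<close>

definition free_module :: "('k, 'u) ring_scheme \<Rightarrow> 'x set \<Rightarrow> ('k, 'x \<Rightarrow> 'k) module"
  where "free_module K X =
    \<lparr>carrier = finsupp K X, mult = undefined, one = undefined,
     zero = (\<lambda>x. \<zero>\<^bsub>K\<^esub>), add = (\<lambda>f g x. f x \<oplus>\<^bsub>K\<^esub> g x),
     smult = (\<lambda>c f x. c \<otimes>\<^bsub>K\<^esub> f x)\<rparr>"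

text \<open>The free algebra on \<open>X\<close>: finite linear combinations of words over \<open>X\<close>, where the coefficient
  of \<open>w\<close> in a product is the sum over all factorizations of \<open>w\<close> into a prefix and a suffix.\<close>

definition free_algebra :: "('k, 'u) ring_scheme \<Rightarrow> 'x set \<Rightarrow> ('k, 'x list \<Rightarrow> 'k) module"
  where "free_algebra K X =
    \<lparr>carrier = finsupp K (lists X),
     mult = (\<lambda>f g w. \<Oplus>\<^bsub>K\<^esub>i\<in>{..length w}. f (take i w) \<otimes>\<^bsub>K\<^esub> g (drop i w)),
     one = basis_vec K [],
     zero = (\<lambda>w. \<zero>\<^bsub>K\<^esub>), add = (\<lambda>f g w. f w \<oplus>\<^bsub>K\<^esub> g w),
     smult = (\<lambda>c f w. c \<otimes>\<^bsub>K\<^esub> f w)\<rparr>"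

text \<open>Quotient of an algebra by a two-sided ideal; also used for the quotient of a module by a
  submodule, in which case the multiplication and unit of the result are meaningless.\<close>

definition quotient_module ::
  "('k, 'a, 'v) module_scheme \<Rightarrow> 'a set \<Rightarrow> ('k, 'a set) module"
  where "quotient_module A I =
    \<lparr>carrier = carrier (A Quot I), mult = mult (A Quot I), one = one (A Quot I),
     zero = zero (A Quot I), add = add (A Quot I),
     smult = (\<lambda>c X. \<Union>x\<in>X. I +>\<^bsub>A\<^esub> (c \<odot>\<^bsub>A\<^esub> x))\<rparr>"

definition submodule_generated ::
  "('k, 'u) ring_scheme \<Rightarrow> ('k, 'm, 'v) module_scheme \<Rightarrow> 'm set \<Rightarrow> 'm set"
  where "submodule_generated K M S = \<Inter>{H. submodule H K M \<and> S \<subseteq> H}"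

section \<open>Tensor products\<close>

definition tensor_relations ::
  "('k, 'u) ring_scheme \<Rightarrow> ('k, 'm, 'v) module_scheme \<Rightarrow> ('k, 'n, 'w) module_scheme
    \<Rightarrow> ('m \<times> 'n \<Rightarrow> 'k) set"
  where "tensor_relations K M N =
    (let F = free_module K (carrier M \<times> carrier N); e = (\<lambda>m n. basis_vec K (m, n)) in
      {e (m \<oplus>\<^bsub>M\<^esub> m') n \<ominus>\<^bsub>F\<^esub> (e m n \<oplus>\<^bsub>F\<^esub> e m' n) | m m' n.
          m \<in> carrier M \<and> m' \<in> carrier M \<and> n \<in> carrier N} \<union>
      {e m (n \<oplus>\<^bsub>N\<^esub> n') \<ominus>\<^bsub>F\<^esub> (e m n \<oplus>\<^bsub>F\<^esub> e m n') | m n n'.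
          m \<in> carrier M \<and> n \<in> carrier N \<and> n' \<in> carrier N} \<union>
      {e (c \<odot>\<^bsub>M\<^esub> m) n \<ominus>\<^bsub>F\<^esub> (c \<odot>\<^bsub>F\<^esub> e m n) | c m n.
          c \<in> carrier K \<and> m \<in> carrier M \<and> n \<in> carrier N} \<union>
      {e m (c \<odot>\<^bsub>N\<^esub> n) \<ominus>\<^bsub>F\<^esub> (c \<odot>\<^bsub>F\<^esub> e m n) | c m n.
          c \<in> carrier K \<and> m \<in> carrier M \<and> n \<in> carrier N})"

definition tensor_submodule ::
  "('k, 'u) ring_scheme \<Rightarrow> ('k, 'm, 'v) module_scheme \<Rightarrow> ('k, 'n, 'w) module_scheme
    \<Rightarrow> ('m \<times> 'n \<Rightarrow> 'k) set"
  where "tensor_submodule K M N =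
    submodule_generated K (free_module K (carrier M \<times> carrier N)) (tensor_relations K M N)"

definition tensor_product ::
  "('k, 'u) ring_scheme \<Rightarrow> ('k, 'm, 'v) module_scheme \<Rightarrow> ('k, 'n, 'w) module_scheme
    \<Rightarrow> ('k, ('m \<times> 'n \<Rightarrow> 'k) set) module"
  where "tensor_product K M N =
    quotient_module (free_module K (carrier M \<times> carrier N)) (tensor_submodule K M N)"

definition pure_tensor ::
  "('k, 'u) ring_scheme \<Rightarrow> ('k, 'm, 'v) module_scheme \<Rightarrow> ('k, 'n, 'w) module_scheme
    \<Rightarrow> 'm \<Rightarrow> 'n \<Rightarrow> ('m \<times> 'n \<Rightarrow> 'k) set"
  where "pure_tensor K M N m n =
    tensor_submodule K M N +>\<^bsub>free_module K (carrier M \<times> carrier N)\<^esub> basis_vec K (m, n)"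

text \<open>The linear map on a tensor product induced by a bilinear map \<open>\<beta>\<close> with values in \<open>W\<close>: the
  linear extension of \<open>\<beta>\<close> to the free module vanishes on the tensor relations, hence is constant
  on each class, and this constant value is returned.\<close>

definition linear_ext ::
  "('k, 'u) ring_scheme \<Rightarrow> ('k, 'w, 'v) module_scheme \<Rightarrow> ('x \<Rightarrow> 'w) \<Rightarrow> ('x \<Rightarrow> 'k) \<Rightarrow> 'w"
  where "linear_ext K W b f = (\<Oplus>\<^bsub>W\<^esub>x\<in>{x. f x \<noteq> \<zero>\<^bsub>K\<^esub>}. f x \<odot>\<^bsub>W\<^esub> b x)"

definition tensor_lift ::
  "('k, 'u) ring_scheme \<Rightarrow> ('k, 'w, 'v) module_scheme \<Rightarrow> ('m \<Rightarrow> 'n \<Rightarrow> 'w)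
    \<Rightarrow> ('m \<times> 'n \<Rightarrow> 'k) set \<Rightarrow> 'w"
  where "tensor_lift K W \<beta> X = the_elem (linear_ext K W (case_prod \<beta>) ` X)"

section \<open>Free products of algebras\<close>

text \<open>The relations on a free algebra \<open>F\<close> making \<open>j\<close> a homomorphism of unitary algebras.\<close>

definition hom_relations ::
  "('k, 'u) ring_scheme \<Rightarrow> ('k, 'a, 'v) module_scheme \<Rightarrow> ('k, 'f, 'w) module_scheme
    \<Rightarrow> ('a \<Rightarrow> 'f) \<Rightarrow> 'f set"
  where "hom_relations K A F j =
      {j (a \<oplus>\<^bsub>A\<^esub> b) \<ominus>\<^bsub>F\<^esub> (j a \<oplus>\<^bsub>F\<^esub> j b) | a b. a \<in> carrier A \<and> b \<in> carrier A} \<union>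
      {j (c \<odot>\<^bsub>A\<^esub> a) \<ominus>\<^bsub>F\<^esub> (c \<odot>\<^bsub>F\<^esub> j a) | c a. c \<in> carrier K \<and> a \<in> carrier A} \<union>
      {j (a \<otimes>\<^bsub>A\<^esub> b) \<ominus>\<^bsub>F\<^esub> (j a \<otimes>\<^bsub>F\<^esub> j b) | a b. a \<in> carrier A \<and> b \<in> carrier A} \<union>
      {j \<one>\<^bsub>A\<^esub> \<ominus>\<^bsub>F\<^esub> \<one>\<^bsub>F\<^esub>}"

abbreviation (input) free_algebra2 ::
  "('k, 'u) ring_scheme \<Rightarrow> ('k, 'a, 'v) module_scheme \<Rightarrow> ('k, 'b, 'w) module_scheme
    \<Rightarrow> ('k, ('a + 'b) list \<Rightarrow> 'k) module"
  where "free_algebra2 K A B \<equiv> free_algebra K (carrier A <+> carrier B)"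

definition free_product_ideal ::
  "('k, 'u) ring_scheme \<Rightarrow> ('k, 'a, 'v) module_scheme \<Rightarrow> ('k, 'b, 'w) module_scheme
    \<Rightarrow> (('a + 'b) list \<Rightarrow> 'k) set"
  where "free_product_ideal K A B =
    Idl\<^bsub>free_algebra2 K A B\<^esub>
      (hom_relations K A (free_algebra2 K A B) (\<lambda>a. basis_vec K [Inl a]) \<union>
       hom_relations K B (free_algebra2 K A B) (\<lambda>b. basis_vec K [Inr b]))"

definition free_product ::
  "('k, 'u) ring_scheme \<Rightarrow> ('k, 'a, 'v) module_scheme \<Rightarrow> ('k, 'b, 'w) module_scheme
    \<Rightarrow> ('k, (('a + 'b) list \<Rightarrow> 'k) set) module"
  where "free_product K A B =
    quotient_module (free_algebra2 K A B) (free_product_ideal K A B)"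

definition free_product_inl ::
  "('k, 'u) ring_scheme \<Rightarrow> ('k, 'a, 'v) module_scheme \<Rightarrow> ('k, 'b, 'w) module_scheme
    \<Rightarrow> 'a \<Rightarrow> (('a + 'b) list \<Rightarrow> 'k) set"
  where "free_product_inl K A B a =
    free_product_ideal K A B +>\<^bsub>free_algebra2 K A B\<^esub> basis_vec K [Inl a]"

definition free_product_inr ::
  "('k, 'u) ring_scheme \<Rightarrow> ('k, 'a, 'v) module_scheme \<Rightarrow> ('k, 'b, 'w) module_scheme
    \<Rightarrow> 'b \<Rightarrow> (('a + 'b) list \<Rightarrow> 'k) set"
  where "free_product_inr K A B b =
    free_product_ideal K A B +>\<^bsub>free_algebra2 K A B\<^esub> basis_vec K [Inr b]"

section \<open>The ring of Rota-Baxter operators\<close>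

definition rb_relations ::
  "('k, 'u) ring_scheme \<Rightarrow> ('k, 'r, 'v) module_scheme \<Rightarrow> ('r \<Rightarrow> 'r) \<Rightarrow> 'k
    \<Rightarrow> (('r + (nat \<Rightarrow> 'k)) list \<Rightarrow> 'k) set set"
  where "rb_relations K R P lam =
    (let F = free_product K R (UP K);
         \<iota> = free_product_inl K R (UP K);
         Q = free_product_inr K R (UP K) (monom (UP K) \<one>\<^bsub>K\<^esub> 1)
     in {Q \<otimes>\<^bsub>F\<^esub> \<iota> r \<otimes>\<^bsub>F\<^esub> Q \<ominus>\<^bsub>F\<^esub> \<iota> (P r) \<otimes>\<^bsub>F\<^esub> Q \<oplus>\<^bsub>F\<^esub> Q \<otimes>\<^bsub>F\<^esub> \<iota> (P r)
           \<oplus>\<^bsub>F\<^esub> lam \<odot>\<^bsub>F\<^esub> (Q \<otimes>\<^bsub>F\<^esub> \<iota> r) | r. r \<in> carrier R})"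

definition U_RB ::
  "('k, 'u) ring_scheme \<Rightarrow> ('k, 'r, 'v) module_scheme \<Rightarrow> ('r \<Rightarrow> 'r) \<Rightarrow> 'k
    \<Rightarrow> ('k, (('r + (nat \<Rightarrow> 'k)) list \<Rightarrow> 'k) set set) module"
  where "U_RB K R P lam =
    quotient_module (free_product K R (UP K))
      (Idl\<^bsub>free_product K R (UP K)\<^esub> (rb_relations K R P lam))"

section \<open>The algebra on the direct sum of \<open>R\<close> and its tensor square\<close>

definition P_tilde :: "('k, 'u) ring_scheme \<Rightarrow> ('k, 'r, 'v) module_scheme \<Rightarrow> ('r \<Rightarrow> 'r) \<Rightarrow> 'k \<Rightarrow> 'r \<Rightarrow> 'r"
  where "P_tilde K R P lam x = (\<ominus>\<^bsub>K\<^esub> lam) \<odot>\<^bsub>R\<^esub> x \<ominus>\<^bsub>R\<^esub> P x"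

definition tensor_lmult ::
  "('k, 'u) ring_scheme \<Rightarrow> ('k, 'r, 'v) module_scheme
    \<Rightarrow> 'r \<Rightarrow> ('r \<times> 'r \<Rightarrow> 'k) set \<Rightarrow> ('r \<times> 'r \<Rightarrow> 'k) set"
  where "tensor_lmult K R r =
    tensor_lift K (tensor_product K R R) (\<lambda>r1 s1. pure_tensor K R R (r \<otimes>\<^bsub>R\<^esub> r1) s1)"

definition tensor_rmult ::
  "('k, 'u) ring_scheme \<Rightarrow> ('k, 'r, 'v) module_scheme
    \<Rightarrow> ('r \<times> 'r \<Rightarrow> 'k) set \<Rightarrow> 'r \<Rightarrow> ('r \<times> 'r \<Rightarrow> 'k) set"
  where "tensor_rmult K R X s =
    tensor_lift K (tensor_product K R R) (\<lambda>r1 s1. pure_tensor K R R r1 (s1 \<otimes>\<^bsub>R\<^esub> s)) X"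

definition tensor_mult ::
  "('k, 'u) ring_scheme \<Rightarrow> ('k, 'r, 'v) module_scheme \<Rightarrow> ('r \<Rightarrow> 'r) \<Rightarrow> 'k
    \<Rightarrow> ('r \<times> 'r \<Rightarrow> 'k) set \<Rightarrow> ('r \<times> 'r \<Rightarrow> 'k) set \<Rightarrow> ('r \<times> 'r \<Rightarrow> 'k) set"
  where "tensor_mult K R P lam X Y =
    (let T = tensor_product K R R in
      tensor_lift K T (\<lambda>r1 s1.
        tensor_lift K T (\<lambda>r2 s2.
          pure_tensor K R R (r1 \<otimes>\<^bsub>R\<^esub> P (s1 \<otimes>\<^bsub>R\<^esub> r2)) s2
          \<oplus>\<^bsub>T\<^esub> pure_tensor K R R r1 (P_tilde K R P lam (s1 \<otimes>\<^bsub>R\<^esub> r2) \<otimes>\<^bsub>R\<^esub> s2)) Y) X)"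

definition rb_sum_algebra ::
  "('k, 'u) ring_scheme \<Rightarrow> ('k, 'r, 'v) module_scheme \<Rightarrow> ('r \<Rightarrow> 'r) \<Rightarrow> 'k
    \<Rightarrow> ('k, 'r \<times> ('r \<times> 'r \<Rightarrow> 'k) set) module"
  where "rb_sum_algebra K R P lam =
    (let T = tensor_product K R R in
      \<lparr>carrier = carrier R \<times> carrier T,
       mult = (\<lambda>(r, X) (s, Y).
         (r \<otimes>\<^bsub>R\<^esub> s, tensor_lmult K R r Y \<oplus>\<^bsub>T\<^esub> tensor_rmult K R X s \<oplus>\<^bsub>T\<^esub> tensor_mult K R P lam X Y)),
       one = (\<one>\<^bsub>R\<^esub>, \<zero>\<^bsub>T\<^esub>),
       zero = (\<zero>\<^bsub>R\<^esub>, \<zero>\<^bsub>T\<^esub>),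
       add = (\<lambda>(r, X) (s, Y). (r \<oplus>\<^bsub>R\<^esub> s, X \<oplus>\<^bsub>T\<^esub> Y)),
       smult = (\<lambda>c (r, X). (c \<odot>\<^bsub>R\<^esub> r, c \<odot>\<^bsub>T\<^esub> X))\<rparr>)"

end

theory Submission
  imports Defs
begin

text \<open>The element \<open>q = 1 \<otimes> 1\<close> of \<open>R \<oplus> (R \<otimes> R)\<close> satisfies \<open>q r q = P(r) \<otimes> 1 + 1 \<otimes> P\<tilde>(r) =
  P(r) q - q P(r) - \<lambda> q r\<close>, which is the defining relation of \<open>Q\<close>. Hence \<open>r \<mapsto> r\<close>, \<open>Q \<mapsto> q\<close> defines
  an algebra homomorphism \<open>h\<close> on the ring of Rota-Baxter operators. The linear map
  \<open>g (r + r\<^sub>1 \<otimes> s\<^sub>1) = r + r\<^sub>1 Q s\<^sub>1\<close> satisfies \<open>h \<circ> g = id\<close>, and it is surjective because its image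
  contains \<open>1\<close> and is stable under left multiplication by \<open>R\<close> and, by the relation, by \<open>Q\<close>.
  Associativity on \<open>R \<otimes> R\<close> amounts to the two identities
  \<open>P(a) P(b) + P(P\<tilde>(a) b) = P(a P(b))\<close> and \<open>P\<tilde>(a P(b)) + P\<tilde>(a) P\<tilde>(b) = P\<tilde>(P\<tilde>(a) b)\<close>.\<close>

section \<open>Linear maps and quotients\<close>

text \<open>The danger is collapse. The explicit algebra on the direct sum serves as a model
  instead: once it is associative, the universal properties of free algebra, free product and
  quotient produce h, and the left inverse h makes g injective; with g onto, h is bijective. Hence
  the weight of the proof lies in associativity, which is where the Rota-Baxter identity enters. The
  product on R tensor R is forced: (r1 Q s1)(r2 Q s2) = r1 (Q s1 r2 Q) s2, rewritten once by the
  relation. \<open>P_tilde\<close> is chosen so that it absorbs both \<open>lam\<close> and the term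
  Q P(r), which leaves a two-term rewriting rule. Maps out of R tensor R come from bilinear maps,
  and identities on it are checked on pure tensors, which span it additively.\<close>

definition linear_maps ::
  "('k, 'u) ring_scheme \<Rightarrow> ('k, 'm, 'v) module_scheme \<Rightarrow> ('k, 'n, 'w) module_scheme \<Rightarrow> ('m \<Rightarrow> 'n) set"
  where "linear_maps K M N = {f. f \<in> carrier M \<rightarrow> carrier N \<and>
    (\<forall>x\<in>carrier M. \<forall>y\<in>carrier M. f (x \<oplus>\<^bsub>M\<^esub> y) = f x \<oplus>\<^bsub>N\<^esub> f y) \<and>
    (\<forall>c\<in>carrier K. \<forall>x\<in>carrier M. f (c \<odot>\<^bsub>M\<^esub> x) = c \<odot>\<^bsub>N\<^esub> f x)}"

lemma linear_mapsI:
  assumes "\<And>x. x \<in> carrier M \<Longrightarrow> f x \<in> carrier N"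
    and "\<And>x y. \<lbrakk>x \<in> carrier M; y \<in> carrier M\<rbrakk> \<Longrightarrow> f (x \<oplus>\<^bsub>M\<^esub> y) = f x \<oplus>\<^bsub>N\<^esub> f y"
    and "\<And>c x. \<lbrakk>c \<in> carrier K; x \<in> carrier M\<rbrakk> \<Longrightarrow> f (c \<odot>\<^bsub>M\<^esub> x) = c \<odot>\<^bsub>N\<^esub> f x"
  shows "f \<in> linear_maps K M N"
  using assms by (auto simp: linear_maps_def)

lemma linear_mapsD:
  assumes "f \<in> linear_maps K M N"
  shows "x \<in> carrier M \<Longrightarrow> f x \<in> carrier N"
    and "\<lbrakk>x \<in> carrier M; y \<in> carrier M\<rbrakk> \<Longrightarrow> f (x \<oplus>\<^bsub>M\<^esub> y) = f x \<oplus>\<^bsub>N\<^esub> f y"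
    and "\<lbrakk>c \<in> carrier K; x \<in> carrier M\<rbrakk> \<Longrightarrow> f (c \<odot>\<^bsub>M\<^esub> x) = c \<odot>\<^bsub>N\<^esub> f x"
  using assms by (auto simp: linear_maps_def)

lemma linear_map_zero:
  assumes "module K M" "module K N" "f \<in> linear_maps K M N"
  shows "f \<zero>\<^bsub>M\<^esub> = \<zero>\<^bsub>N\<^esub>"
proof -
  interpret M: module K M by fact
  interpret N: module K N by fact
  have "f (\<zero>\<^bsub>K\<^esub> \<odot>\<^bsub>M\<^esub> \<zero>\<^bsub>M\<^esub>) = \<zero>\<^bsub>K\<^esub> \<odot>\<^bsub>N\<^esub> f \<zero>\<^bsub>M\<^esub>"
    using linear_mapsD(3)[OF assms(3)] by blast
  then show ?thesis
    using linear_mapsD(1)[OF assms(3)] by simp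
qed

lemma linear_map_uminus:
  assumes "module K M" "module K N" "f \<in> linear_maps K M N" "x \<in> carrier M"
  shows "f (\<ominus>\<^bsub>M\<^esub> x) = \<ominus>\<^bsub>N\<^esub> f x"
proof -
  interpret M: module K M by fact
  interpret N: module K N by fact
  have "f (\<ominus>\<^bsub>M\<^esub> x) \<oplus>\<^bsub>N\<^esub> f x = \<zero>\<^bsub>N\<^esub>"
    using linear_mapsD(2)[OF assms(3), of "\<ominus>\<^bsub>M\<^esub> x" x] assms linear_map_zero[OF assms(1-3)]
    by (simp add: M.l_neg)
  then show ?thesis
    using N.minus_equality linear_mapsD(1)[OF assms(3)] assms(4) by (metis M.a_inv_closed)
qed

lemma linear_map_minus:
  assumes "module K M" "module K N" "f \<in> linear_maps K M N" "x \<in> carrier M" "y \<in> carrier M"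
  shows "f (x \<ominus>\<^bsub>M\<^esub> y) = f x \<ominus>\<^bsub>N\<^esub> f y"
proof -
  interpret M: module K M by fact
  show ?thesis
    using assms by (simp add: a_minus_def linear_map_uminus linear_mapsD(2)[OF assms(3)])
qed

lemma (in abelian_group) minus_eq_zero_iff:
  assumes "x \<in> carrier G" "y \<in> carrier G"
  shows "x \<ominus> y = \<zero> \<longleftrightarrow> x = y"
  using assms by (metis a_minus_def a_inv_closed minus_equality minus_minus r_neg)

lemma linear_maps_compose:
  assumes "f \<in> linear_maps K M N" "g \<in> linear_maps K N W"
  shows "(\<lambda>x. g (f x)) \<in> linear_maps K M W"
  using assms by (auto simp: linear_maps_def Pi_def)

lemma submodule_kernel:
  assumes "module K M" "module K N" "f \<in> linear_maps K M N"
  shows "submodule {x \<in> carrier M. f x = \<zero>\<^bsub>N\<^esub>} K M"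
proof -
  interpret M: module K M by fact
  interpret N: module K N by fact
  show ?thesis
    using linear_mapsD[OF assms(3)]
    by (intro M.submoduleI) (auto simp: linear_map_zero[OF assms] linear_map_uminus[OF assms])
qed

text \<open>Curried, as linearity in each slot with the other one fixed. Every fact on linear maps,
  preservation of zero in particular, then applies to either slot through
  \<open>bilinear_maps_left\<close> and \<open>bilinear_maps_right\<close>.\<close>

definition bilinear_maps ::
  "('k, 'u) ring_scheme \<Rightarrow> ('k, 'm, 'v) module_scheme \<Rightarrow> ('k, 'n, 'w) module_scheme
    \<Rightarrow> ('k, 'p, 'x) module_scheme \<Rightarrow> ('m \<Rightarrow> 'n \<Rightarrow> 'p) set"
  where "bilinear_maps K M N W = {\<beta>. (\<forall>m\<in>carrier M. \<beta> m \<in> linear_maps K N W) \<and>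
    (\<forall>n\<in>carrier N. (\<lambda>m. \<beta> m n) \<in> linear_maps K M W)}"

lemma bilinear_mapsI:
  assumes "\<And>m. m \<in> carrier M \<Longrightarrow> \<beta> m \<in> linear_maps K N W"
    and "\<And>n. n \<in> carrier N \<Longrightarrow> (\<lambda>m. \<beta> m n) \<in> linear_maps K M W"
  shows "\<beta> \<in> bilinear_maps K M N W"
  using assms by (simp add: bilinear_maps_def)

lemma bilinear_mapsD:
  assumes "\<beta> \<in> bilinear_maps K M N W"
  shows "\<lbrakk>m \<in> carrier M; n \<in> carrier N\<rbrakk> \<Longrightarrow> \<beta> m n \<in> carrier W"
    and "\<lbrakk>m \<in> carrier M; m' \<in> carrier M; n \<in> carrier N\<rbrakk>
      \<Longrightarrow> \<beta> (m \<oplus>\<^bsub>M\<^esub> m') n = \<beta> m n \<oplus>\<^bsub>W\<^esub> \<beta> m' n"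
    and "\<lbrakk>m \<in> carrier M; n \<in> carrier N; n' \<in> carrier N\<rbrakk>
      \<Longrightarrow> \<beta> m (n \<oplus>\<^bsub>N\<^esub> n') = \<beta> m n \<oplus>\<^bsub>W\<^esub> \<beta> m n'"
    and "\<lbrakk>c \<in> carrier K; m \<in> carrier M; n \<in> carrier N\<rbrakk> \<Longrightarrow> \<beta> (c \<odot>\<^bsub>M\<^esub> m) n = c \<odot>\<^bsub>W\<^esub> \<beta> m n"
    and "\<lbrakk>c \<in> carrier K; m \<in> carrier M; n \<in> carrier N\<rbrakk> \<Longrightarrow> \<beta> m (c \<odot>\<^bsub>N\<^esub> n) = c \<odot>\<^bsub>W\<^esub> \<beta> m n"
  using assms unfolding bilinear_maps_def by (auto simp: linear_maps_def)

lemma bilinear_maps_left: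
  "\<lbrakk>\<beta> \<in> bilinear_maps K M N W; n \<in> carrier N\<rbrakk> \<Longrightarrow> (\<lambda>m. \<beta> m n) \<in> linear_maps K M W"
  by (simp add: bilinear_maps_def)

lemma bilinear_maps_right:
  "\<lbrakk>\<beta> \<in> bilinear_maps K M N W; m \<in> carrier M\<rbrakk> \<Longrightarrow> \<beta> m \<in> linear_maps K N W"
  by (simp add: bilinear_maps_def)

lemma linear_maps_cong:
  assumes "\<And>x. x \<in> carrier M \<Longrightarrow> f x = g x" "g \<in> linear_maps K M N" "module K M"
  shows "f \<in> linear_maps K M N"
proof -
  interpret module K M by fact
  show ?thesis using assms(1,2) by (auto simp: linear_maps_def Pi_def)
qed

lemma linear_maps_add:
  assumes "module K N" "f \<in> linear_maps K M N" "g \<in> linear_maps K M N"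
  shows "(\<lambda>x. f x \<oplus>\<^bsub>N\<^esub> g x) \<in> linear_maps K M N"
proof -
  interpret N: module K N by fact
  show ?thesis
    using linear_mapsD[OF assms(2)] linear_mapsD[OF assms(3)]
    by (intro linear_mapsI) (simp_all add: N.smult_r_distr N.a_ac)
qed

lemma linear_maps_smult:
  assumes "module K N" "f \<in> linear_maps K M N" "c \<in> carrier K"
  shows "(\<lambda>x. c \<odot>\<^bsub>N\<^esub> f x) \<in> linear_maps K M N"
proof -
  interpret N: module K N by fact
  \<comment> \<open>Commutativity of K is what makes a scalar multiple of a linear map linear
    again.\<close>
  have "c \<odot>\<^bsub>N\<^esub> (d \<odot>\<^bsub>N\<^esub> y) = d \<odot>\<^bsub>N\<^esub> (c \<odot>\<^bsub>N\<^esub> y)" if "d \<in> carrier K" "y \<in> carrier N" for d y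
    using that assms(3) by (metis N.m_comm N.smult_assoc1)
  then show ?thesis
    using linear_mapsD[OF assms(2)] assms(3)
    by (intro linear_mapsI) (simp_all add: N.smult_r_distr)
qed

definition algebra_homs ::
  "('k, 'u) ring_scheme \<Rightarrow> ('k, 'a, 'v) module_scheme \<Rightarrow> ('k, 'b, 'w) module_scheme \<Rightarrow> ('a \<Rightarrow> 'b) set"
  where "algebra_homs K A B = ring_hom A B \<inter> linear_maps K A B"

lemma algebra_homsI:
  assumes "f \<in> linear_maps K A B" "f \<one>\<^bsub>A\<^esub> = \<one>\<^bsub>B\<^esub>"
    and "\<And>x y. \<lbrakk>x \<in> carrier A; y \<in> carrier A\<rbrakk> \<Longrightarrow> f (x \<otimes>\<^bsub>A\<^esub> y) = f x \<otimes>\<^bsub>B\<^esub> f y"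
  shows "f \<in> algebra_homs K A B"
  using assms(2,3) linear_mapsD[OF assms(1)] assms(1)
  by (auto simp: algebra_homs_def intro!: ring_hom_memI)

lemma algebra_homsD:
  assumes "f \<in> algebra_homs K A B"
  shows "f \<in> linear_maps K A B"
    and "f \<one>\<^bsub>A\<^esub> = \<one>\<^bsub>B\<^esub>"
    and "\<lbrakk>x \<in> carrier A; y \<in> carrier A\<rbrakk> \<Longrightarrow> f (x \<otimes>\<^bsub>A\<^esub> y) = f x \<otimes>\<^bsub>B\<^esub> f y"
  using assms by (auto simp: algebra_homs_def ring_hom_def)

lemma algebra_homs_compose:
  assumes "f \<in> algebra_homs K A B" "g \<in> algebra_homs K B C"
  shows "(\<lambda>x. g (f x)) \<in> algebra_homs K A C"
  using assms linear_maps_compose[of f K A B g C]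
  by (auto simp: algebra_homs_def ring_hom_def Pi_def)

lemma algebra_isoI:
  assumes "f \<in> algebra_homs K A B" "inj_on f (carrier A)" "f ` carrier A = carrier B"
  shows "f \<in> algebra_iso K A B"
  using assms
  by (auto simp: algebra_iso_def algebra_homs_def ring_iso_def bij_betw_def linear_maps_def)

lemma assoc_algebraI:
  assumes "module K A"
    and "\<one>\<^bsub>A\<^esub> \<in> carrier A"
    and "\<And>x y. \<lbrakk>x \<in> carrier A; y \<in> carrier A\<rbrakk> \<Longrightarrow> x \<otimes>\<^bsub>A\<^esub> y \<in> carrier A"
    and "\<And>x y z. \<lbrakk>x \<in> carrier A; y \<in> carrier A; z \<in> carrier A\<rbrakk>
      \<Longrightarrow> (x \<otimes>\<^bsub>A\<^esub> y) \<otimes>\<^bsub>A\<^esub> z = x \<otimes>\<^bsub>A\<^esub> (y \<otimes>\<^bsub>A\<^esub> z)"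
    and "\<And>x. x \<in> carrier A \<Longrightarrow> \<one>\<^bsub>A\<^esub> \<otimes>\<^bsub>A\<^esub> x = x"
    and "\<And>x. x \<in> carrier A \<Longrightarrow> x \<otimes>\<^bsub>A\<^esub> \<one>\<^bsub>A\<^esub> = x"
    and "mult A \<in> bilinear_maps K A A A"
  shows "assoc_algebra K A"
proof -
  interpret module K A by fact
  note bil = bilinear_mapsD[OF assms(7)]
  have "ring A"
    by (rule ringI) (use assms(2-6) bil in \<open>auto intro!: monoidI M.abelian_group_axioms\<close>)
  then show ?thesis
    by (intro assoc_algebra.intro assoc_algebra_axioms.intro module_axioms bil)
qed

context assoc_algebra begin

lemma module_K: "module K A"
  by (rule module_axioms)

lemma ring_A: "ring A"
  by (rule ring_axioms)

lemma mult_bilinear: "mult A \<in> bilinear_maps K A A A"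
  by (intro bilinear_mapsI linear_mapsI)
    (auto simp: smult_mult_left smult_mult_right l_distr r_distr)

text \<open>Ring ideals say nothing about scalars, but in a unital algebra c x = (c 1) x is a ring
  product. This allows the ring-theoretic \<open>Idl\<close> to generate the ideals of
  k-algebras.\<close>

lemma ideal_submodule:
  assumes "ideal I A"
  shows "submodule I K A"
proof -
  interpret I: ideal I A by fact
  show ?thesis
  proof (rule submoduleI)
    fix c x assume "c \<in> carrier K" "x \<in> I"
    then have "c \<odot>\<^bsub>A\<^esub> x = (c \<odot>\<^bsub>A\<^esub> \<one>\<^bsub>A\<^esub>) \<otimes>\<^bsub>A\<^esub> x"
      using smult_mult_left[of c "\<one>\<^bsub>A\<^esub>" x] I.a_Hcarr by simp
    then show "c \<odot>\<^bsub>A\<^esub> x \<in> I"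
      using I.I_l_closed \<open>x \<in> I\<close> \<open>c \<in> carrier K\<close> by simp
  qed (use I.a_subset in auto)
qed

end

section \<open>Quotients by submodules and ideals, and the maps induced on them\<close>

lemma quotient_module_simps:
  "carrier (quotient_module A I) = (\<lambda>x. I +>\<^bsub>A\<^esub> x) ` carrier A"
  "zero (quotient_module A I) = I"
  "one (quotient_module A I) = I +>\<^bsub>A\<^esub> \<one>\<^bsub>A\<^esub>"
  "mult (quotient_module A I) = rcoset_mult A I"
  "add (quotient_module A I) = set_add A"
  by (auto simp: quotient_module_def FactRing_def A_RCOSETS_def')

context module begin

context
  fixes H
  assumes H: "submodule H R M"
begin

lemma abelian_subgroup_submodule: "abelian_subgroup H M"
  by (intro abelian_subgroupI3 additive_subgroupI M.abelian_group_axioms submodule.axioms(1)[OF H])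

lemma quotient_add:
  assumes "x \<in> carrier M" "y \<in> carrier M"
  shows "(H +>\<^bsub>M\<^esub> x) \<oplus>\<^bsub>quotient_module M H\<^esub> (H +>\<^bsub>M\<^esub> y) = H +>\<^bsub>M\<^esub> (x \<oplus>\<^bsub>M\<^esub> y)"
  using assms abelian_subgroup.a_rcos_sum[OF abelian_subgroup_submodule]
  by (simp add: quotient_module_simps)

lemma coset_eqI:
  assumes "x \<in> carrier M" "h \<in> H"
  shows "H +>\<^bsub>M\<^esub> (h \<oplus>\<^bsub>M\<^esub> x) = H +>\<^bsub>M\<^esub> x"
proof -
  interpret S: abelian_subgroup H M by (rule abelian_subgroup_submodule)
  have "h \<oplus>\<^bsub>M\<^esub> x \<in> H +>\<^bsub>M\<^esub> x"
    using assms a_rcosI S.a_subset by simp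
  from a_repr_independence[OF this assms(1) S.a_subgroup] show ?thesis by simp
qed

lemma coset_elemE:
  assumes "y \<in> H +>\<^bsub>M\<^esub> x"
  obtains h where "h \<in> H" "y = h \<oplus>\<^bsub>M\<^esub> x"
  using assms by (auto simp: a_r_coset_def')

text \<open>The scalar action is defined as a union over all representatives y of the class. Two
  representatives differ by some h in H, and c h lies in H again, so the cosets in the union
  coincide.\<close>

lemma quotient_smult:
  assumes "c \<in> carrier R" "x \<in> carrier M"
  shows "c \<odot>\<^bsub>quotient_module M H\<^esub> (H +>\<^bsub>M\<^esub> x) = H +>\<^bsub>M\<^esub> (c \<odot>\<^bsub>M\<^esub> x)"
proof -
  interpret S: abelian_subgroup H M by (rule abelian_subgroup_submodule)
  interpret submodule H R M by (rule H)
  have "H +>\<^bsub>M\<^esub> (c \<odot>\<^bsub>M\<^esub> y) = H +>\<^bsub>M\<^esub> (c \<odot>\<^bsub>M\<^esub> x)" if "y \<in> H +>\<^bsub>M\<^esub> x" for y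
    using that by (rule coset_elemE) (use assms S.a_Hcarr in \<open>simp add: smult_r_distr coset_eqI\<close>)
  \<comment> \<open>The class is nonempty; otherwise the union below would be empty.\<close>
  moreover have "x \<in> H +>\<^bsub>M\<^esub> x"
    using assms S.a_rcos_self by simp
  ultimately have "(\<Union>y\<in>H +>\<^bsub>M\<^esub> x. H +>\<^bsub>M\<^esub> (c \<odot>\<^bsub>M\<^esub> y)) = H +>\<^bsub>M\<^esub> (c \<odot>\<^bsub>M\<^esub> x)"
    by blast
  then show ?thesis
    by (simp add: quotient_module_def)
qed

lemma quotient_zero_iff:
  assumes "x \<in> carrier M"
  shows "H +>\<^bsub>M\<^esub> x = \<zero>\<^bsub>quotient_module M H\<^esub> \<longleftrightarrow> x \<in> H"
  using assms a_coset_join1[OF _ _ submodule.axioms(1)[OF H]] a_coset_join2[OF _ submodule.axioms(1)[OF H]]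
  by (metis quotient_module_simps(2))

lemma module_quotient: "module R (quotient_module M H)"
proof (rule moduleI)
  have zero: "\<zero>\<^bsub>quotient_module M H\<^esub> = H +>\<^bsub>M\<^esub> \<zero>\<^bsub>M\<^esub>"
    using quotient_zero_iff[of "\<zero>\<^bsub>M\<^esub>"] subgroup.one_closed[OF submodule.axioms(1)[OF H]] by simp
  have "\<exists>y\<in>carrier M. H +>\<^bsub>M\<^esub> (y \<oplus>\<^bsub>M\<^esub> x) = H +>\<^bsub>M\<^esub> \<zero>\<^bsub>M\<^esub>" if "x \<in> carrier M" for x
    using that M.l_neg M.a_inv_closed by metis
  then show "abelian_group (quotient_module M H)"
    by (intro abelian_groupI) (auto simp: quotient_module_simps(1) zero quotient_add M.a_ac)
qed (auto simp: quotient_module_simps(1) quotient_add quotient_smult smult_l_distr smult_r_distr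
    smult_assoc1 R.is_cring)

lemma quotient_linear: "(\<lambda>x. H +>\<^bsub>M\<^esub> x) \<in> linear_maps R M (quotient_module M H)"
  by (auto intro!: linear_mapsI simp: quotient_add quotient_smult quotient_module_simps(1))

context
  fixes N f
  assumes N: "module R N" and f: "f \<in> linear_maps R M N"
    and vanish: "\<And>x. x \<in> H \<Longrightarrow> f x = \<zero>\<^bsub>N\<^esub>"
begin

text \<open>Well-definedness of the induced map: f kills H, so the image of a coset is a singleton
  and \<open>the_elem\<close> returns its element.\<close>

lemma the_elem_coset:
  assumes "x \<in> carrier M"
  shows "the_elem (f ` (H +>\<^bsub>M\<^esub> x)) = f x"
proof -
  interpret N: module R N by (rule N)
  interpret S: abelian_subgroup H M by (rule abelian_subgroup_submodule)
  have "f y = f x" if "y \<in> H +>\<^bsub>M\<^esub> x" for y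
    using that
    by (rule coset_elemE) (use assms S.a_Hcarr vanish linear_mapsD[OF f] in simp)
  moreover have "x \<in> H +>\<^bsub>M\<^esub> x"
    using assms S.a_rcos_self by simp
  ultimately have "f ` (H +>\<^bsub>M\<^esub> x) = {f x}" by blast
  then show ?thesis by simp
qed

lemma quotient_induced_linear:
  "(\<lambda>X. the_elem (f ` X)) \<in> linear_maps R (quotient_module M H) N"
  by (rule linear_mapsI)
    (auto simp: quotient_module_simps(1) quotient_add quotient_smult the_elem_coset linear_mapsD[OF f])

end

end

end

text \<open>Both the tensor relations and the homomorphism relations are differences; this turns
  membership of such a difference in H into an equation between classes.\<close>

lemma (in module) coset_eq_minusI:
  assumes H: "submodule H R M" and x: "x \<in> carrier M" "y \<in> carrier M" "x \<ominus>\<^bsub>M\<^esub> y \<in> H"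
  shows "H +>\<^bsub>M\<^esub> x = H +>\<^bsub>M\<^esub> y"
proof -
  interpret Q: module R "quotient_module M H" by (rule module_quotient[OF H])
  have "(H +>\<^bsub>M\<^esub> x) \<ominus>\<^bsub>quotient_module M H\<^esub> (H +>\<^bsub>M\<^esub> y) = \<zero>\<^bsub>quotient_module M H\<^esub>"
    using x by (simp add: quotient_zero_iff[OF H] M.minus_closed
        flip: linear_map_minus[OF module_axioms module_quotient[OF H] quotient_linear[OF H]])
  then show ?thesis
    using x linear_mapsD(1)[OF quotient_linear[OF H]] by (simp add: Q.minus_eq_zero_iff)
qed

context assoc_algebra begin

context
  fixes I
  assumes I: "ideal I A"
begin

lemma quotient_mult:
  assumes "x \<in> carrier A" "y \<in> carrier A"
  shows "(I +>\<^bsub>A\<^esub> x) \<otimes>\<^bsub>quotient_module A I\<^esub> (I +>\<^bsub>A\<^esub> y) = I +>\<^bsub>A\<^esub> (x \<otimes>\<^bsub>A\<^esub> y)"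
  using assms ideal.rcoset_mult_add[OF I] by (simp add: quotient_module_simps)

lemma assoc_algebra_quotient: "assoc_algebra K (quotient_module A I)"
proof (rule assoc_algebraI)
  note S = ideal_submodule[OF I]
  note q = quotient_mult quotient_add[OF S] quotient_smult[OF S]
  show "mult (quotient_module A I) \<in> bilinear_maps K (quotient_module A I) (quotient_module A I) (quotient_module A I)"
    by (intro bilinear_mapsI linear_mapsI)
      (auto simp: quotient_module_simps(1) q l_distr r_distr smult_mult_left smult_mult_right)
qed (auto simp: quotient_module_simps(1,3) quotient_mult m_assoc module_quotient ideal_submodule[OF I])

lemma quotient_algebra_hom: "(\<lambda>x. I +>\<^bsub>A\<^esub> x) \<in> algebra_homs K A (quotient_module A I)"
  by (rule algebra_homsI)
    (auto simp: quotient_linear ideal_submodule[OF I] quotient_mult quotient_module_simps(3))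

lemma quotient_induced_algebra_hom:
  assumes B: "assoc_algebra K B" and f: "f \<in> algebra_homs K A B"
    and vanish: "\<And>x. x \<in> I \<Longrightarrow> f x = \<zero>\<^bsub>B\<^esub>"
  shows "(\<lambda>X. the_elem (f ` X)) \<in> algebra_homs K (quotient_module A I) B"
proof -
  note c = ideal_submodule[OF I] assoc_algebra.module_K[OF B] algebra_homsD(1)[OF f] vanish
  show ?thesis
    by (intro algebra_homsI quotient_induced_linear c)
      (auto simp: quotient_module_simps(1,3) quotient_mult the_elem_coset[OF c] algebra_homsD[OF f])
qed

end

text \<open>Combined with minimality of generated ideals: a homomorphism that kills the generators
  kills the whole ideal and so factors through the quotient.\<close>

lemma algebra_hom_kernel_ideal:
  assumes B: "assoc_algebra K B" and f: "f \<in> algebra_homs K A B"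
  shows "ideal {x \<in> carrier A. f x = \<zero>\<^bsub>B\<^esub>} A"
proof -
  interpret B: assoc_algebra K B by fact
  have "submodule {x \<in> carrier A. f x = \<zero>\<^bsub>B\<^esub>} K A"
    by (rule submodule_kernel[OF module_K B.module_K algebra_homsD(1)[OF f]])
  then show ?thesis
    using linear_mapsD(1)[OF algebra_homsD(1)[OF f]]
    by (intro idealI submodule.axioms ring_A) (auto simp: algebra_homsD(3)[OF f])
qed

end

section \<open>Relations that force a map to become an algebra homomorphism\<close>

lemma hom_relations_memI:
  "\<lbrakk>a \<in> carrier A; b \<in> carrier A\<rbrakk> \<Longrightarrow> j (a \<oplus>\<^bsub>A\<^esub> b) \<ominus>\<^bsub>F\<^esub> (j a \<oplus>\<^bsub>F\<^esub> j b) \<in> hom_relations K A F j"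
  "\<lbrakk>c \<in> carrier K; a \<in> carrier A\<rbrakk> \<Longrightarrow> j (c \<odot>\<^bsub>A\<^esub> a) \<ominus>\<^bsub>F\<^esub> (c \<odot>\<^bsub>F\<^esub> j a) \<in> hom_relations K A F j"
  "\<lbrakk>a \<in> carrier A; b \<in> carrier A\<rbrakk> \<Longrightarrow> j (a \<otimes>\<^bsub>A\<^esub> b) \<ominus>\<^bsub>F\<^esub> (j a \<otimes>\<^bsub>F\<^esub> j b) \<in> hom_relations K A F j"
  "j \<one>\<^bsub>A\<^esub> \<ominus>\<^bsub>F\<^esub> \<one>\<^bsub>F\<^esub> \<in> hom_relations K A F j"
  unfolding hom_relations_def
     apply (intro UnI1 CollectI exI conjI, rule refl, assumption+)
    apply (rule UnI1, rule UnI1, rule UnI2, intro CollectI exI conjI, rule refl, assumption+)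
   apply (rule UnI1, rule UnI2, intro CollectI exI conjI, rule refl, assumption+)
  apply (rule UnI2, rule singletonI)
  done

context assoc_algebra begin

text \<open>The map \<open>j\<close> is a mere insertion of letters and respects no structure. Each
  of the four families of relations supplies one homomorphism law modulo I.\<close>

lemma hom_relations_quotient:
  assumes B: "assoc_algebra K B" and j: "\<And>b. b \<in> carrier B \<Longrightarrow> j b \<in> carrier A"
    and I: "ideal I A" and rel: "hom_relations K B A j \<subseteq> I"
  shows "(\<lambda>b. I +>\<^bsub>A\<^esub> j b) \<in> algebra_homs K B (quotient_module A I)"
proof -
  interpret B: assoc_algebra K B by (rule B)
  note S = ideal_submodule[OF I]
  have r: "\<lbrakk>a \<in> carrier B; b \<in> carrier B\<rbrakk> \<Longrightarrow> j (a \<oplus>\<^bsub>B\<^esub> b) \<ominus>\<^bsub>A\<^esub> (j a \<oplus>\<^bsub>A\<^esub> j b) \<in> I"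
    "\<lbrakk>c \<in> carrier K; a \<in> carrier B\<rbrakk> \<Longrightarrow> j (c \<odot>\<^bsub>B\<^esub> a) \<ominus>\<^bsub>A\<^esub> (c \<odot>\<^bsub>A\<^esub> j a) \<in> I"
    "\<lbrakk>a \<in> carrier B; b \<in> carrier B\<rbrakk> \<Longrightarrow> j (a \<otimes>\<^bsub>B\<^esub> b) \<ominus>\<^bsub>A\<^esub> (j a \<otimes>\<^bsub>A\<^esub> j b) \<in> I"
    "j \<one>\<^bsub>B\<^esub> \<ominus>\<^bsub>A\<^esub> \<one>\<^bsub>A\<^esub> \<in> I" for a b c
       apply (rule subsetD[OF rel], rule hom_relations_memI, assumption+)
      apply (rule subsetD[OF rel], rule hom_relations_memI, assumption+)
     apply (rule subsetD[OF rel], rule hom_relations_memI, assumption+)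
    apply (rule subsetD[OF rel], rule hom_relations_memI)
    done
  have eq1: "I +>\<^bsub>A\<^esub> j (a \<oplus>\<^bsub>B\<^esub> b) = I +>\<^bsub>A\<^esub> (j a \<oplus>\<^bsub>A\<^esub> j b)" if "a \<in> carrier B" "b \<in> carrier B" for a b
    by (rule coset_eq_minusI[OF S]) (use that j r(1) in simp_all)
  have eq2: "I +>\<^bsub>A\<^esub> j (c \<odot>\<^bsub>B\<^esub> a) = I +>\<^bsub>A\<^esub> (c \<odot>\<^bsub>A\<^esub> j a)" if "c \<in> carrier K" "a \<in> carrier B" for a c
    by (rule coset_eq_minusI[OF S]) (use that j r(2) in simp_all)
  have eq3: "I +>\<^bsub>A\<^esub> j (a \<otimes>\<^bsub>B\<^esub> b) = I +>\<^bsub>A\<^esub> (j a \<otimes>\<^bsub>A\<^esub> j b)" if "a \<in> carrier B" "b \<in> carrier B" for a b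
    by (rule coset_eq_minusI[OF S]) (use that j r(3) in simp_all)
  have eq4: "I +>\<^bsub>A\<^esub> j \<one>\<^bsub>B\<^esub> = I +>\<^bsub>A\<^esub> \<one>\<^bsub>A\<^esub>"
    by (rule coset_eq_minusI[OF S]) (use j r(4) in simp_all)
  show ?thesis
    by (intro algebra_homsI linear_mapsI)
      (simp_all add: j eq1 eq2 eq3 eq4 quotient_add[OF S] quotient_smult[OF S] quotient_mult[OF I]
        linear_mapsD(1)[OF quotient_linear[OF S]] quotient_module_simps(3))
qed

lemma hom_relations_closed:
  assumes "assoc_algebra K B" "\<And>b. b \<in> carrier B \<Longrightarrow> j b \<in> carrier A"
  shows "hom_relations K B A j \<subseteq> carrier A"
proof -
  interpret B: assoc_algebra K B by fact
  show ?thesis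
    using assms(2) by (auto simp: hom_relations_def)
qed

text \<open>Counterpart of \<open>hom_relations_quotient\<close>: since f after \<open>j\<close> is
  the homomorphism \<open>g\<close>, both sides of every relation have the same image under
  f.\<close>

lemma hom_relations_kernel:
  assumes B: "assoc_algebra K B" and C: "assoc_algebra K C"
    and j: "\<And>b. b \<in> carrier B \<Longrightarrow> j b \<in> carrier A"
    and f: "f \<in> algebra_homs K A C" and g: "g \<in> algebra_homs K B C"
    and fj: "\<And>b. b \<in> carrier B \<Longrightarrow> f (j b) = g b"
  shows "hom_relations K B A j \<subseteq> {x \<in> carrier A. f x = \<zero>\<^bsub>C\<^esub>}"
proof -
  interpret B: assoc_algebra K B by (rule B)
  interpret C: assoc_algebra K C by (rule C)
  note F = algebra_homsD[OF f] and G = algebra_homsD[OF g]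
  have "f z = \<zero>\<^bsub>C\<^esub>" if "z \<in> hom_relations K B A j" for z
    using that unfolding hom_relations_def
    by (auto simp: linear_map_minus[OF module_K C.module_K F(1)] j fj linear_mapsD[OF F(1)] F(2,3)
        linear_mapsD[OF G(1)] G(2,3) C.minus_eq_zero_iff)
  then show ?thesis
    using hom_relations_closed[of B j, OF B j] by blast
qed

end

section \<open>Modules of finitely supported functions and tensor products\<close>

text \<open>Common interface of free modules, free algebras and k[Q], so that linear extension and
  induction are proved once; the multiplication is left open. The operations are prescribed on
  finitely supported functions only, since those of \<open>UP K\<close> are specified only on its
  carrier.\<close>

locale finsupp_module = cring K for K :: "('k, 'u) ring_scheme" (structure) +
  fixes X :: "'x set" and M :: "('k, 'x \<Rightarrow> 'k, 'v) module_scheme"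
  assumes carrier_eq: "carrier M = finsupp K X"
    and zero_eq: "\<zero>\<^bsub>M\<^esub> = (\<lambda>x. \<zero>)"
    and add_eq: "\<lbrakk>f \<in> finsupp K X; g \<in> finsupp K X\<rbrakk> \<Longrightarrow> f \<oplus>\<^bsub>M\<^esub> g = (\<lambda>x. f x \<oplus> g x)"
    and smult_eq: "\<lbrakk>c \<in> carrier K; f \<in> finsupp K X\<rbrakk> \<Longrightarrow> c \<odot>\<^bsub>M\<^esub> f = (\<lambda>x. c \<otimes> f x)"
begin

lemma finsuppD:
  assumes "f \<in> finsupp K X"
  shows "f x \<in> carrier K" "finite {x. f x \<noteq> \<zero>}" "{x. f x \<noteq> \<zero>} \<subseteq> X"
  using assms by (auto simp: finsupp_def)

lemma zero_finsupp: "(\<lambda>x. \<zero>) \<in> finsupp K X"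
  by (simp add: finsupp_def)

lemma finsupp_add:
  assumes "f \<in> finsupp K X" "g \<in> finsupp K X"
  shows "(\<lambda>x. f x \<oplus> g x) \<in> finsupp K X"
proof -
  have "{x. f x \<oplus> g x \<noteq> \<zero>} \<subseteq> {x. f x \<noteq> \<zero>} \<union> {x. g x \<noteq> \<zero>}" by auto
  then show ?thesis
    using assms by (auto simp: finsupp_def intro: finite_subset)
qed

lemma finsupp_smult:
  assumes "c \<in> carrier K" "f \<in> finsupp K X"
  shows "(\<lambda>x. c \<otimes> f x) \<in> finsupp K X"
proof -
  have "{x. c \<otimes> f x \<noteq> \<zero>} \<subseteq> {x. f x \<noteq> \<zero>}" using assms by auto
  then show ?thesis
    using assms by (auto simp: finsupp_def intro: finite_subset)
qed

lemma basis_vec_finsupp: "x \<in> X \<Longrightarrow> basis_vec K x \<in> finsupp K X"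
  by (auto simp: finsupp_def basis_vec_def intro: finite_subset[of _ "{x}"])

lemma basis_vec_closed: "x \<in> X \<Longrightarrow> basis_vec K x \<in> carrier M"
  by (simp add: carrier_eq basis_vec_finsupp)

lemma finsupp_is_module: "module K M"
proof (rule moduleI)
  have "\<exists>g\<in>finsupp K X. g \<oplus>\<^bsub>M\<^esub> f = (\<lambda>x. \<zero>)" if f: "f \<in> finsupp K X" for f
  proof
    show g: "(\<lambda>x. (\<ominus> \<one>) \<otimes> f x) \<in> finsupp K X"
      using finsupp_smult f by simp
    show "(\<lambda>x. (\<ominus> \<one>) \<otimes> f x) \<oplus>\<^bsub>M\<^esub> f = (\<lambda>x. \<zero>)"
      using f g by (subst add_eq) (auto simp: finsuppD(1) l_minus l_neg)
  qed
  then show "abelian_group M"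
    by (intro abelian_groupI)
      (auto simp: carrier_eq zero_eq add_eq finsupp_add zero_finsupp finsuppD(1) a_ac)
qed (auto simp: carrier_eq add_eq smult_eq finsupp_add finsupp_smult finsuppD(1) l_distr r_distr
    m_assoc is_cring)

sublocale module K M
  by (rule finsupp_is_module)

text \<open>Purely additive induction: scalars occur in the basis case, so closure of Q under scalar
  multiples is never a proof obligation.\<close>

lemma finsupp_induct [consumes 1, case_names zero add basis]:
  assumes "f \<in> carrier M"
    and zero: "Q \<zero>\<^bsub>M\<^esub>"
    and add: "\<And>f g. \<lbrakk>f \<in> carrier M; g \<in> carrier M; Q f; Q g\<rbrakk> \<Longrightarrow> Q (f \<oplus>\<^bsub>M\<^esub> g)"
    and basis: "\<And>c x. \<lbrakk>c \<in> carrier K; x \<in> X\<rbrakk> \<Longrightarrow> Q (c \<odot>\<^bsub>M\<^esub> basis_vec K x)"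
  shows "Q f"
proof -
  \<comment> \<open>Generalized from the support to any finite set A containing it, so that the
    induction runs over A while f varies.\<close>
  have "Q f" if "finite A" "f \<in> finsupp K X" "{x. f x \<noteq> \<zero>} \<subseteq> A" "A \<subseteq> X" for A f
    using that
  proof (induction A arbitrary: f rule: finite_induct)
    case empty
    then have "f = \<zero>\<^bsub>M\<^esub>" by (auto simp: zero_eq)
    then show ?case using zero by simp
  next
    case (insert x A)
    \<comment> \<open>Erasing the coefficient at x splits f into a function supported in A and a
      multiple of one basis vector.\<close>
    define g where "g = f(x := \<zero>)"
    have g: "g \<in> finsupp K X"
      using insert.prems(1) unfolding g_def
      by (auto simp: finsupp_def intro: rev_finite_subset[of "{x. f x \<noteq> \<zero>}"])
    have e: "f x \<odot>\<^bsub>M\<^esub> basis_vec K x \<in> carrier M"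
      using insert.prems by (simp add: basis_vec_closed finsuppD(1))
    have "f x \<odot>\<^bsub>M\<^esub> basis_vec K x = (\<lambda>y. if y = x then f x else \<zero>)"
      using insert.prems finsuppD(1)[OF insert.prems(1)]
      by (subst smult_eq) (auto simp: basis_vec_finsupp, auto simp: basis_vec_def)
    then have "f = g \<oplus>\<^bsub>M\<^esub> (f x \<odot>\<^bsub>M\<^esub> basis_vec K x)"
      using e g finsuppD(1)[OF insert.prems(1)]
      by (auto simp: add_eq carrier_eq g_def)
    moreover have "Q g"
      using insert.prems by (intro insert.IH g) (auto simp: g_def)
    ultimately show ?case
      using add[of g "f x \<odot>\<^bsub>M\<^esub> basis_vec K x"] basis[of "f x" x] e g insert.prems
      by (simp add: carrier_eq finsuppD(1))
  qed
  from this[of "{x. f x \<noteq> \<zero>}" f] assms(1) show ?thesis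
    by (auto simp: carrier_eq finsupp_def)
qed

context
  fixes W :: "('k, 'w, 'z) module_scheme" and b :: "'x \<Rightarrow> 'w"
  assumes W: "module K W" and b: "\<And>x. x \<in> X \<Longrightarrow> b x \<in> carrier W"
begin

text \<open>\<open>linear_ext\<close> sums over the support, which shrinks under cancellation.
  Additivity needs the sums for f, g and f + g over one common index set.\<close>

lemma linear_ext_superset:
  assumes "f \<in> finsupp K X" "finite A" "{x. f x \<noteq> \<zero>} \<subseteq> A" "A \<subseteq> X"
  shows "linear_ext K W b f = (\<Oplus>\<^bsub>W\<^esub>x\<in>A. f x \<odot>\<^bsub>W\<^esub> b x)"
proof -
  interpret W: module K W by (rule W)
  show ?thesis
    unfolding linear_ext_def
    using assms b by (intro W.add.finprod_mono_neutral_cong_left) (auto simp: finsuppD(1)[OF assms(1)])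
qed

lemma linear_ext_linear: "linear_ext K W b \<in> linear_maps K M W"
proof (rule linear_mapsI)
  interpret W: module K W by (rule W)
  note coeff = finsuppD(1)
  have val: "\<lbrakk>h \<in> finsupp K X; x \<in> X\<rbrakk> \<Longrightarrow> h x \<odot>\<^bsub>W\<^esub> b x \<in> carrier W" for h x
    using b coeff by simp
  show "linear_ext K W b f \<in> carrier W" if "f \<in> carrier M" for f
    using that finsuppD[of f] val unfolding linear_ext_def
    by (intro W.finsum_closed) (auto simp: carrier_eq)
  fix f g assume fg: "f \<in> carrier M" "g \<in> carrier M"
  then have fg': "f \<in> finsupp K X" "g \<in> finsupp K X" by (auto simp: carrier_eq)
  let ?A = "{x. f x \<noteq> \<zero>} \<union> {x. g x \<noteq> \<zero>}"
  have A: "finite ?A" "?A \<subseteq> X" using finsuppD[OF fg'(1)] finsuppD[OF fg'(2)] by auto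
  have "linear_ext K W b (f \<oplus>\<^bsub>M\<^esub> g) = (\<Oplus>\<^bsub>W\<^esub>x\<in>?A. (f x \<oplus> g x) \<odot>\<^bsub>W\<^esub> b x)"
    using A fg' by (subst linear_ext_superset[of _ ?A]) (auto simp: add_eq finsupp_add)
  also have "\<dots> = (\<Oplus>\<^bsub>W\<^esub>x\<in>?A. f x \<odot>\<^bsub>W\<^esub> b x \<oplus>\<^bsub>W\<^esub> g x \<odot>\<^bsub>W\<^esub> b x)"
    using A fg' b val by (intro W.finsum_cong') (auto simp: W.smult_l_distr coeff)
  also have "\<dots> = (\<Oplus>\<^bsub>W\<^esub>x\<in>?A. f x \<odot>\<^bsub>W\<^esub> b x) \<oplus>\<^bsub>W\<^esub> (\<Oplus>\<^bsub>W\<^esub>x\<in>?A. g x \<odot>\<^bsub>W\<^esub> b x)"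
    using A val fg' by (intro W.finsum_addf) auto
  also have "\<dots> = linear_ext K W b f \<oplus>\<^bsub>W\<^esub> linear_ext K W b g"
    using A fg' by (simp add: linear_ext_superset[of _ ?A])
  finally show "linear_ext K W b (f \<oplus>\<^bsub>M\<^esub> g) = linear_ext K W b f \<oplus>\<^bsub>W\<^esub> linear_ext K W b g" .
next
  interpret W: module K W by (rule W)
  fix c f assume c: "c \<in> carrier K" and "f \<in> carrier M"
  then have f: "f \<in> finsupp K X" by (simp add: carrier_eq)
  let ?A = "{x. f x \<noteq> \<zero>}"
  have A: "finite ?A" "?A \<subseteq> X" using finsuppD[OF f] by auto
  have val: "x \<in> X \<Longrightarrow> f x \<odot>\<^bsub>W\<^esub> b x \<in> carrier W" for x
    using b finsuppD(1)[OF f] by simp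
  have "linear_ext K W b (c \<odot>\<^bsub>M\<^esub> f) = (\<Oplus>\<^bsub>W\<^esub>x\<in>?A. (c \<otimes> f x) \<odot>\<^bsub>W\<^esub> b x)"
    using A f c by (subst linear_ext_superset[of _ ?A]) (auto simp: smult_eq finsupp_smult)
  also have "\<dots> = (\<Oplus>\<^bsub>W\<^esub>x\<in>?A. c \<odot>\<^bsub>W\<^esub> (f x \<odot>\<^bsub>W\<^esub> b x))"
    using A f b c val by (intro W.finsum_cong') (auto simp: W.smult_assoc1 finsuppD(1))
  also have "\<dots> = c \<odot>\<^bsub>W\<^esub> linear_ext K W b f"
    using A c val by (subst W.finsum_smult_ldistr[symmetric]) (auto simp: linear_ext_def)
  finally show "linear_ext K W b (c \<odot>\<^bsub>M\<^esub> f) = c \<odot>\<^bsub>W\<^esub> linear_ext K W b f" .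
qed

lemma linear_ext_basis:
  assumes "x \<in> X"
  shows "linear_ext K W b (basis_vec K x) = b x"
proof -
  interpret W: module K W by (rule W)
  \<comment> \<open>Summing over {x} also covers the trivial ring, where
    \<open>basis_vec K x\<close> is zero and has empty support.\<close>
  have "linear_ext K W b (basis_vec K x) = (\<Oplus>\<^bsub>W\<^esub>y\<in>{x}. basis_vec K x y \<odot>\<^bsub>W\<^esub> b y)"
    using assms by (intro linear_ext_superset basis_vec_finsupp) (auto simp: basis_vec_def)
  also have "\<dots> = b x"
    using assms b by (simp add: basis_vec_def)
  finally show ?thesis .
qed

end

end

lemma finsupp_module_free_module:
  assumes "cring K"
  shows "finsupp_module K X (free_module K X)"
  using assms by (intro finsupp_module.intro finsupp_module_axioms.intro) (auto simp: free_module_def)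

section \<open>Generated submodules and the universal property of the tensor product\<close>

context module begin

lemma submodule_generated_submodule:
  assumes "S \<subseteq> carrier M"
  shows "submodule (submodule_generated R M S) R M"
proof (rule submoduleI)
  show "submodule_generated R M S \<subseteq> carrier M"
    using assms carrier_is_submodule by (auto simp: submodule_generated_def)
qed (auto simp: submodule_generated_def submoduleE dest: subgroup.one_closed[OF submodule.axioms(1)])

lemma submodule_generated_incl: "S \<subseteq> submodule_generated R M S"
  by (auto simp: submodule_generated_def)

lemma submodule_generated_minimal:
  "\<lbrakk>submodule H R M; S \<subseteq> H\<rbrakk> \<Longrightarrow> submodule_generated R M S \<subseteq> H"
  by (auto simp: submodule_generated_def)

end

locale tensor = M: module K M + N: module K N
  for K :: "('k, 'u) ring_scheme" (structure)
    and M :: "('k, 'm, 'v) module_scheme" and N :: "('k, 'n, 'w) module_scheme"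
begin

abbreviation "F \<equiv> free_module K (carrier M \<times> carrier N)"
abbreviation "T \<equiv> tensor_product K M N"
abbreviation "pt \<equiv> pure_tensor K M N"
abbreviation "Rel \<equiv> tensor_submodule K M N"

sublocale F: finsupp_module K "carrier M \<times> carrier N" F
  by (intro finsupp_module_free_module M.R.is_cring)

lemma tensor_relations_cases:
  assumes "z \<in> tensor_relations K M N"
    and "\<And>m m' n. \<lbrakk>m \<in> carrier M; m' \<in> carrier M; n \<in> carrier N;
        z = basis_vec K (m \<oplus>\<^bsub>M\<^esub> m', n) \<ominus>\<^bsub>F\<^esub> (basis_vec K (m, n) \<oplus>\<^bsub>F\<^esub> basis_vec K (m', n))\<rbrakk> \<Longrightarrow> Q"
    and "\<And>m n n'. \<lbrakk>m \<in> carrier M; n \<in> carrier N; n' \<in> carrier N;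
        z = basis_vec K (m, n \<oplus>\<^bsub>N\<^esub> n') \<ominus>\<^bsub>F\<^esub> (basis_vec K (m, n) \<oplus>\<^bsub>F\<^esub> basis_vec K (m, n'))\<rbrakk> \<Longrightarrow> Q"
    and "\<And>c m n. \<lbrakk>c \<in> carrier K; m \<in> carrier M; n \<in> carrier N;
        z = basis_vec K (c \<odot>\<^bsub>M\<^esub> m, n) \<ominus>\<^bsub>F\<^esub> (c \<odot>\<^bsub>F\<^esub> basis_vec K (m, n))\<rbrakk> \<Longrightarrow> Q"
    and "\<And>c m n. \<lbrakk>c \<in> carrier K; m \<in> carrier M; n \<in> carrier N;
        z = basis_vec K (m, c \<odot>\<^bsub>N\<^esub> n) \<ominus>\<^bsub>F\<^esub> (c \<odot>\<^bsub>F\<^esub> basis_vec K (m, n))\<rbrakk> \<Longrightarrow> Q"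
  shows Q
  using assms(1) unfolding tensor_relations_def Let_def
  by (elim UnE CollectE exE conjE; elim assms(2-5))

lemma tensor_relations_memI:
  "\<lbrakk>m \<in> carrier M; m' \<in> carrier M; n \<in> carrier N\<rbrakk> \<Longrightarrow>
    basis_vec K (m \<oplus>\<^bsub>M\<^esub> m', n) \<ominus>\<^bsub>F\<^esub> (basis_vec K (m, n) \<oplus>\<^bsub>F\<^esub> basis_vec K (m', n))
      \<in> tensor_relations K M N"
  "\<lbrakk>m \<in> carrier M; n \<in> carrier N; n' \<in> carrier N\<rbrakk> \<Longrightarrow>
    basis_vec K (m, n \<oplus>\<^bsub>N\<^esub> n') \<ominus>\<^bsub>F\<^esub> (basis_vec K (m, n) \<oplus>\<^bsub>F\<^esub> basis_vec K (m, n'))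
      \<in> tensor_relations K M N"
  "\<lbrakk>c \<in> carrier K; m \<in> carrier M; n \<in> carrier N\<rbrakk> \<Longrightarrow>
    basis_vec K (c \<odot>\<^bsub>M\<^esub> m, n) \<ominus>\<^bsub>F\<^esub> (c \<odot>\<^bsub>F\<^esub> basis_vec K (m, n)) \<in> tensor_relations K M N"
  "\<lbrakk>c \<in> carrier K; m \<in> carrier M; n \<in> carrier N\<rbrakk> \<Longrightarrow>
    basis_vec K (m, c \<odot>\<^bsub>N\<^esub> n) \<ominus>\<^bsub>F\<^esub> (c \<odot>\<^bsub>F\<^esub> basis_vec K (m, n)) \<in> tensor_relations K M N"
  unfolding tensor_relations_def Let_def
     apply (intro UnI1 CollectI exI conjI, rule refl, assumption+)
    apply (rule UnI1, rule UnI1, rule UnI2, intro CollectI exI conjI, rule refl, assumption+)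
   apply (rule UnI1, rule UnI2, intro CollectI exI conjI, rule refl, assumption+)
  apply (rule UnI2, intro CollectI exI conjI, rule refl, assumption+)
  done

lemma tensor_relations_closed: "tensor_relations K M N \<subseteq> carrier F"
  by (rule subsetI, erule tensor_relations_cases) (simp_all add: F.basis_vec_closed)

lemma Rel_submodule: "submodule Rel K F"
  unfolding tensor_submodule_def
  by (rule F.submodule_generated_submodule[OF tensor_relations_closed])

lemma module_T: "module K T"
  unfolding tensor_product_def by (rule F.module_quotient[OF Rel_submodule])

sublocale T: module K T
  by (rule module_T)

lemma class_linear: "(\<lambda>z. Rel +>\<^bsub>F\<^esub> z) \<in> linear_maps K F T"
  unfolding tensor_product_def by (rule F.quotient_linear[OF Rel_submodule])

lemma coset_relation:
  assumes "x \<in> carrier F" "y \<in> carrier F" "x \<ominus>\<^bsub>F\<^esub> y \<in> tensor_relations K M N"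
  shows "Rel +>\<^bsub>F\<^esub> x = Rel +>\<^bsub>F\<^esub> y"
  using assms F.submodule_generated_incl
  by (intro F.coset_eq_minusI[OF Rel_submodule]) (auto simp: tensor_submodule_def)

lemma pure_tensor_bilinear: "pt \<in> bilinear_maps K M N T"
proof -
  \<comment> \<open>Used from right to left, linearity of the class map gathers each side of a goal
    into a single coset; the difference of the representatives is then one of the tensor
    relations.\<close>
  note basic = F.basis_vec_closed linear_mapsD(2,3)[OF class_linear, symmetric]
  show ?thesis
  proof (intro bilinear_mapsI linear_mapsI)
    fix m n assume mn: "m \<in> carrier M" "n \<in> carrier N"
    then show "pt m n \<in> carrier T" "pt m n \<in> carrier T"
      using linear_mapsD(1)[OF class_linear] by (auto simp: pure_tensor_def F.basis_vec_closed)
    show "pt m (n \<oplus>\<^bsub>N\<^esub> n') = pt m n \<oplus>\<^bsub>T\<^esub> pt m n'" if "n' \<in> carrier N" for n'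
      unfolding pure_tensor_def using mn that
      by (simp add: basic, intro coset_relation tensor_relations_memI) (simp_all add: F.basis_vec_closed)
    show "pt (m \<oplus>\<^bsub>M\<^esub> m') n = pt m n \<oplus>\<^bsub>T\<^esub> pt m' n" if "m' \<in> carrier M" for m'
      unfolding pure_tensor_def using mn that
      by (simp add: basic, intro coset_relation tensor_relations_memI) (simp_all add: F.basis_vec_closed)
    fix c assume "c \<in> carrier K"
    with mn show "pt (c \<odot>\<^bsub>M\<^esub> m) n = c \<odot>\<^bsub>T\<^esub> pt m n"
      unfolding pure_tensor_def
      by (simp add: basic, intro coset_relation tensor_relations_memI) (simp_all add: F.basis_vec_closed)
    from mn \<open>c \<in> carrier K\<close> show "pt m (c \<odot>\<^bsub>N\<^esub> n) = c \<odot>\<^bsub>T\<^esub> pt m n"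
      unfolding pure_tensor_def
      by (simp add: basic, intro coset_relation tensor_relations_memI) (simp_all add: F.basis_vec_closed)
  qed
qed

lemmas pure_tensor_simps = bilinear_mapsD[OF pure_tensor_bilinear]

text \<open>Elements of the free module are linear combinations of basis vectors, but a coefficient
  c moves into the first factor, c (m, n) becoming the class of (c m, n). Hence pure tensors
  generate under addition alone.\<close>

lemma tensor_induct [consumes 1, case_names zero add pure]:
  assumes "X \<in> carrier T"
    and zero: "Q \<zero>\<^bsub>T\<^esub>"
    and add: "\<And>X Y. \<lbrakk>X \<in> carrier T; Y \<in> carrier T; Q X; Q Y\<rbrakk> \<Longrightarrow> Q (X \<oplus>\<^bsub>T\<^esub> Y)"
    and pure: "\<And>m n. \<lbrakk>m \<in> carrier M; n \<in> carrier N\<rbrakk> \<Longrightarrow> Q (pt m n)"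
  shows "Q X"
proof -
  obtain z where z: "z \<in> carrier F" "X = Rel +>\<^bsub>F\<^esub> z"
    using assms(1) by (auto simp: tensor_product_def quotient_module_simps(1))
  note cl = linear_mapsD[OF class_linear]
  from z(1) have "Q (Rel +>\<^bsub>F\<^esub> z)"
  proof (induction z rule: F.finsupp_induct)
    case zero
    then show ?case
      using assms(2) linear_map_zero[OF F.module_axioms module_T class_linear] by simp
  next
    case (add f g)
    then show ?case using assms(3) cl by simp
  next
    case (basis c x)
    then obtain m n where x: "x = (m, n)" "m \<in> carrier M" "n \<in> carrier N" by auto
    have "Rel +>\<^bsub>F\<^esub> (c \<odot>\<^bsub>F\<^esub> basis_vec K x) = pt (c \<odot>\<^bsub>M\<^esub> m) n"
      using basis x cl(3) F.basis_vec_closed pure_tensor_simps(4)[of c m n] by (simp add: pure_tensor_def)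
    then show ?case using pure x basis by simp
  qed
  with z(2) show ?thesis by simp
qed

context
  fixes W :: "('k, 'p, 'z) module_scheme" and \<beta>
  assumes W: "module K W" and \<beta>: "\<beta> \<in> bilinear_maps K M N W"
begin

lemma tensor_ext_linear: "linear_ext K W (case_prod \<beta>) \<in> linear_maps K F W"
  using bilinear_mapsD(1)[OF \<beta>] by (intro F.linear_ext_linear W) auto

lemma tensor_ext_basis:
  "\<lbrakk>m \<in> carrier M; n \<in> carrier N\<rbrakk> \<Longrightarrow> linear_ext K W (case_prod \<beta>) (basis_vec K (m, n)) = \<beta> m n"
  using bilinear_mapsD(1)[OF \<beta>] by (subst F.linear_ext_basis[OF W]) auto

text \<open>Bilinearity kills the four families of relations, and the kernel, being a submodule,
  contains the submodule that they generate.\<close>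

lemma tensor_ext_vanish:
  assumes "z \<in> Rel"
  shows "linear_ext K W (case_prod \<beta>) z = \<zero>\<^bsub>W\<^esub>"
proof -
  interpret W: module K W by (rule W)
  let ?f = "linear_ext K W (case_prod \<beta>)"
  note ext = linear_mapsD[OF tensor_ext_linear] linear_map_minus[OF F.module_axioms W tensor_ext_linear]
    tensor_ext_basis F.basis_vec_closed bilinear_mapsD[OF \<beta>]
  have "tensor_relations K M N \<subseteq> {z \<in> carrier F. ?f z = \<zero>\<^bsub>W\<^esub>}"
    by (rule subsetI, erule tensor_relations_cases) (simp_all add: ext W.r_neg a_minus_def[of W])
  then have "Rel \<subseteq> {z \<in> carrier F. ?f z = \<zero>\<^bsub>W\<^esub>}"
    unfolding tensor_submodule_def
    by (intro F.submodule_generated_minimal submodule_kernel F.module_axioms W tensor_ext_linear)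
  with assms show ?thesis by auto
qed

lemma tensor_lift_linear: "tensor_lift K W \<beta> \<in> linear_maps K T W"
  using F.quotient_induced_linear[OF Rel_submodule W tensor_ext_linear tensor_ext_vanish]
  by (simp add: tensor_product_def tensor_lift_def[abs_def])

lemma tensor_lift_pure:
  "\<lbrakk>m \<in> carrier M; n \<in> carrier N\<rbrakk> \<Longrightarrow> tensor_lift K W \<beta> (pt m n) = \<beta> m n"
  using F.the_elem_coset[OF Rel_submodule W tensor_ext_linear tensor_ext_vanish]
  by (simp add: tensor_lift_def pure_tensor_def tensor_ext_basis F.basis_vec_closed)

end

text \<open>For lifts that depend on a parameter r: linearity in r need only be known on pure
  tensors, because the X for which the value is linear in r are closed under sums. It supplies the
  two actions of R and both levels of the nested lift in \<open>tensor_mult\<close>.\<close>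

lemma tensor_lift_bilinear:
  assumes W: "module K W" and L: "module K L"
    and \<beta>: "\<And>r. r \<in> carrier L \<Longrightarrow> \<beta> r \<in> bilinear_maps K M N W"
    and lin: "\<And>m n. \<lbrakk>m \<in> carrier M; n \<in> carrier N\<rbrakk> \<Longrightarrow> (\<lambda>r. \<beta> r m n) \<in> linear_maps K L W"
  shows "(\<lambda>r. tensor_lift K W (\<beta> r)) \<in> bilinear_maps K L T W"
proof (intro bilinear_mapsI)
  interpret W: module K W by (rule W)
  interpret L: module K L by (rule L)
  note lift = tensor_lift_linear[OF W \<beta>]
  show "r \<in> carrier L \<Longrightarrow> tensor_lift K W (\<beta> r) \<in> linear_maps K T W" for r
    by (rule lift)
  fix X assume "X \<in> carrier T"
  then show "(\<lambda>r. tensor_lift K W (\<beta> r) X) \<in> linear_maps K L W"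
  proof (induction X rule: tensor_induct)
    case zero
    show ?case
      by (intro linear_mapsI) (simp_all add: linear_map_zero[OF module_T W lift])
  next
    case (add X Y)
    have "(\<lambda>r. tensor_lift K W (\<beta> r) X \<oplus>\<^bsub>W\<^esub> tensor_lift K W (\<beta> r) Y) \<in> linear_maps K L W"
      using add by (intro linear_maps_add W)
    then show ?case
      by (rule linear_maps_cong[rotated]) (use add L linear_mapsD(2)[OF lift] in auto)
  next
    case (pure m n)
    show ?case
      by (rule linear_maps_cong[OF _ lin L]) (use pure tensor_lift_pure[OF W \<beta>] in auto)
  qed
qed

end

section \<open>Algebra laws and homomorphisms checked on basis vectors\<close>

context finsupp_module begin

text \<open>Both sides of associativity are trilinear, so the three arguments are released from
  basis vectors one at a time, the last one first.\<close>

lemma assoc_algebra_basisI: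
  assumes bil: "mult M \<in> bilinear_maps K M M M"
    and one: "\<one>\<^bsub>M\<^esub> \<in> carrier M"
    and assoc: "\<And>x y z. \<lbrakk>x \<in> X; y \<in> X; z \<in> X\<rbrakk> \<Longrightarrow>
      (basis_vec K x \<otimes>\<^bsub>M\<^esub> basis_vec K y) \<otimes>\<^bsub>M\<^esub> basis_vec K z =
      basis_vec K x \<otimes>\<^bsub>M\<^esub> (basis_vec K y \<otimes>\<^bsub>M\<^esub> basis_vec K z)"
    and units: "\<And>x. x \<in> X \<Longrightarrow> \<one>\<^bsub>M\<^esub> \<otimes>\<^bsub>M\<^esub> basis_vec K x = basis_vec K x"
      "\<And>x. x \<in> X \<Longrightarrow> basis_vec K x \<otimes>\<^bsub>M\<^esub> \<one>\<^bsub>M\<^esub> = basis_vec K x"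
  shows "assoc_algebra K M"
proof (rule assoc_algebraI[OF module_axioms one _ _ _ _ bil])
  note d = bilinear_mapsD[OF bil] basis_vec_closed one
    linear_map_zero[OF module_axioms module_axioms bilinear_maps_left[OF bil]]
    linear_map_zero[OF module_axioms module_axioms bilinear_maps_right[OF bil]]
  show "x \<otimes>\<^bsub>M\<^esub> y \<in> carrier M" if "x \<in> carrier M" "y \<in> carrier M" for x y
    using d(1) that by blast
  have 1: "(basis_vec K x \<otimes>\<^bsub>M\<^esub> basis_vec K y) \<otimes>\<^bsub>M\<^esub> h = basis_vec K x \<otimes>\<^bsub>M\<^esub> (basis_vec K y \<otimes>\<^bsub>M\<^esub> h)"
    if "x \<in> X" "y \<in> X" "h \<in> carrier M" for x y h
    using that(3,1,2) by (induction h rule: finsupp_induct) (simp_all add: assoc d)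
  have 2: "(basis_vec K x \<otimes>\<^bsub>M\<^esub> g) \<otimes>\<^bsub>M\<^esub> h = basis_vec K x \<otimes>\<^bsub>M\<^esub> (g \<otimes>\<^bsub>M\<^esub> h)"
    if "x \<in> X" "g \<in> carrier M" "h \<in> carrier M" for x g h
    using that(2,1,3) by (induction g rule: finsupp_induct) (simp_all add: 1 d)
  show "(f \<otimes>\<^bsub>M\<^esub> g) \<otimes>\<^bsub>M\<^esub> h = f \<otimes>\<^bsub>M\<^esub> (g \<otimes>\<^bsub>M\<^esub> h)"
    if "f \<in> carrier M" "g \<in> carrier M" "h \<in> carrier M" for f g h
    using that by (induction f rule: finsupp_induct) (simp_all add: 2 d)
  show "\<one>\<^bsub>M\<^esub> \<otimes>\<^bsub>M\<^esub> f = f" "f \<otimes>\<^bsub>M\<^esub> \<one>\<^bsub>M\<^esub> = f" if "f \<in> carrier M" for f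
    using that by (induction f rule: finsupp_induct; simp add: units d)+
qed

lemma algebra_hom_basisI:
  assumes A: "assoc_algebra K M" and B: "assoc_algebra K B"
    and f: "f \<in> linear_maps K M B" "f \<one>\<^bsub>M\<^esub> = \<one>\<^bsub>B\<^esub>"
    and mult: "\<And>x y. \<lbrakk>x \<in> X; y \<in> X\<rbrakk> \<Longrightarrow>
      f (basis_vec K x \<otimes>\<^bsub>M\<^esub> basis_vec K y) = f (basis_vec K x) \<otimes>\<^bsub>B\<^esub> f (basis_vec K y)"
  shows "f \<in> algebra_homs K M B"
proof (rule algebra_homsI)
  show "f \<in> linear_maps K M B" "f \<one>\<^bsub>M\<^esub> = \<one>\<^bsub>B\<^esub>" by (fact f)+
  interpret A: assoc_algebra K M by (rule A)
  interpret B: assoc_algebra K B by (rule B)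
  note d = bilinear_mapsD[OF A.mult_bilinear] bilinear_mapsD[OF B.mult_bilinear] basis_vec_closed
    linear_mapsD[OF f(1)] linear_map_zero[OF A.module_K B.module_K f(1)]
  have 1: "f (basis_vec K x \<otimes>\<^bsub>M\<^esub> h) = f (basis_vec K x) \<otimes>\<^bsub>B\<^esub> f h" if "x \<in> X" "h \<in> carrier M" for x h
    using that(2,1) by (induction h rule: finsupp_induct) (simp_all add: mult d)
  show "f (g \<otimes>\<^bsub>M\<^esub> h) = f g \<otimes>\<^bsub>B\<^esub> f h" if "g \<in> carrier M" "h \<in> carrier M" for g h
    using that by (induction g rule: finsupp_induct) (simp_all add: 1 d)
qed

end

section \<open>Free algebras and polynomials\<close>

locale free_alg = cring K for K :: "('k, 'u) ring_scheme" (structure) +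
  fixes X :: "'x set"
begin

abbreviation "FA \<equiv> free_algebra K X"

sublocale FA: finsupp_module K "lists X" FA
  by (intro finsupp_module.intro finsupp_module_axioms.intro is_cring) (auto simp: free_algebra_def)

lemma free_algebra_mult: "f \<otimes>\<^bsub>FA\<^esub> g = (\<lambda>w. \<Oplus>i\<in>{..length w}. f (take i w) \<otimes> g (drop i w))"
  by (simp add: free_algebra_def)

lemma free_algebra_one: "\<one>\<^bsub>FA\<^esub> = basis_vec K []"
  by (simp add: free_algebra_def)

text \<open>A nonzero coefficient at w requires a split of w into two words from the supports of f
  and g, so the support of the product lies in the finite set \<open>?S\<close> of their
  concatenations.\<close>

lemma free_algebra_mult_closed:
  assumes "f \<in> carrier FA" "g \<in> carrier FA"
  shows "f \<otimes>\<^bsub>FA\<^esub> g \<in> carrier FA"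
proof -
  have fg: "f \<in> finsupp K (lists X)" "g \<in> finsupp K (lists X)"
    using assms by (simp_all add: FA.carrier_eq)
  note val = FA.finsuppD(1)[OF fg(1)] FA.finsuppD(1)[OF fg(2)]
  let ?S = "(\<lambda>(u, v). u @ v) ` ({u. f u \<noteq> \<zero>} \<times> {v. g v \<noteq> \<zero>})"
  have "w \<in> ?S" if "(f \<otimes>\<^bsub>FA\<^esub> g) w \<noteq> \<zero>" for w
  proof (rule ccontr)
    assume w: "w \<notin> ?S"
    have "f (take i w) \<otimes> g (drop i w) = \<zero>" for i
    proof (rule ccontr)
      assume "f (take i w) \<otimes> g (drop i w) \<noteq> \<zero>"
      then have "(take i w, drop i w) \<in> {u. f u \<noteq> \<zero>} \<times> {v. g v \<noteq> \<zero>}"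
        using val by auto
      then have "take i w @ drop i w \<in> ?S" by (auto intro!: image_eqI)
      then show False using w by simp
    qed
    then show False using that by (simp add: free_algebra_mult)
  qed
  then have "{w. (f \<otimes>\<^bsub>FA\<^esub> g) w \<noteq> \<zero>} \<subseteq> ?S" by blast
  moreover have "finite ?S" "?S \<subseteq> lists X"
    using FA.finsuppD[OF fg(1)] FA.finsuppD[OF fg(2)] by (auto simp: subset_eq in_lists_conv_set)
  ultimately have "finite {w. (f \<otimes>\<^bsub>FA\<^esub> g) w \<noteq> \<zero>}" "{w. (f \<otimes>\<^bsub>FA\<^esub> g) w \<noteq> \<zero>} \<subseteq> lists X"
    by (auto intro: finite_subset)
  moreover have "(f \<otimes>\<^bsub>FA\<^esub> g) w \<in> carrier K" for w
    by (simp add: free_algebra_mult val)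
  ultimately show ?thesis
    by (simp add: FA.carrier_eq finsupp_def)
qed

lemma free_algebra_mult_bilinear: "mult FA \<in> bilinear_maps K FA FA FA"
proof (intro bilinear_mapsI linear_mapsI)
  fix f g h c assume f: "f \<in> carrier FA" and g: "g \<in> carrier FA"
  then have fs: "f \<in> finsupp K (lists X)" "g \<in> finsupp K (lists X)"
    by (auto simp: FA.carrier_eq)
  note val = FA.finsuppD(1)[OF fs(1)] FA.finsuppD(1)[OF fs(2)]
  show "f \<otimes>\<^bsub>FA\<^esub> g \<in> carrier FA" "f \<otimes>\<^bsub>FA\<^esub> g \<in> carrier FA"
    using f g by (rule free_algebra_mult_closed)+
  { fix h assume h: "h \<in> carrier FA"
    then have "h \<in> finsupp K (lists X)" by (simp add: FA.carrier_eq)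
    note val = val FA.finsuppD(1)[OF this]
    show "f \<otimes>\<^bsub>FA\<^esub> (g \<oplus>\<^bsub>FA\<^esub> h) = f \<otimes>\<^bsub>FA\<^esub> g \<oplus>\<^bsub>FA\<^esub> f \<otimes>\<^bsub>FA\<^esub> h"
      by (simp add: free_algebra_def val r_distr finsum_addf)
    show "(g \<oplus>\<^bsub>FA\<^esub> h) \<otimes>\<^bsub>FA\<^esub> f = g \<otimes>\<^bsub>FA\<^esub> f \<oplus>\<^bsub>FA\<^esub> h \<otimes>\<^bsub>FA\<^esub> f"
      by (simp add: free_algebra_def val l_distr finsum_addf) }
  { fix c assume c: "c \<in> carrier K"
    show "f \<otimes>\<^bsub>FA\<^esub> (c \<odot>\<^bsub>FA\<^esub> g) = c \<odot>\<^bsub>FA\<^esub> (f \<otimes>\<^bsub>FA\<^esub> g)"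
      by (simp add: free_algebra_def val c m_lcomm finsum_rdistr)
    show "(c \<odot>\<^bsub>FA\<^esub> g) \<otimes>\<^bsub>FA\<^esub> f = c \<odot>\<^bsub>FA\<^esub> (g \<otimes>\<^bsub>FA\<^esub> f)"
      by (simp add: free_algebra_def val c m_assoc finsum_rdistr) }
qed

text \<open>Among all splits of w only the one after \<open>length u\<close> letters can match u,
  and it contributes 1 exactly if w = u @ v.\<close>

lemma free_algebra_mult_basis: "basis_vec K u \<otimes>\<^bsub>FA\<^esub> basis_vec K v = basis_vec K (u @ v)"
proof
  fix w :: "'x list"
  have "(basis_vec K u \<otimes>\<^bsub>FA\<^esub> basis_vec K v) w =
    (\<Oplus>i\<in>{..length w}. basis_vec K u (take i w) \<otimes> basis_vec K v (drop i w))"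
    by (simp add: free_algebra_mult)
  also have "\<dots> = (\<Oplus>i\<in>{..length w}. if length u = i then basis_vec K (u @ v) w else \<zero>)"
  proof (intro finsum_cong')
    fix i assume "i \<in> {..length w}"
    then have "w = u @ v \<and> length u = i \<longleftrightarrow> take i w = u \<and> drop i w = v"
      by (auto simp: append_eq_conv_conj)
    then show "basis_vec K u (take i w) \<otimes> basis_vec K v (drop i w) =
        (if length u = i then basis_vec K (u @ v) w else \<zero>)"
      by (auto simp: basis_vec_def)
  qed (auto simp: basis_vec_def)
  also have "\<dots> = basis_vec K (u @ v) w"
  \<comment> \<open>This decides whether the one relevant split position is in the range of
    summation; if not, w is too short to be u @ v and both sides are zero.\<close>
  proof (cases "length u \<le> length w")
    case True
    then show ?thesis
      by (subst finsum_singleton) (auto simp: basis_vec_def)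
  next
    case False
    then show ?thesis
      by (subst finsum_cong'[where g = "\<lambda>_. \<zero>"]) (auto simp: basis_vec_def)
  qed
  finally show "(basis_vec K u \<otimes>\<^bsub>FA\<^esub> basis_vec K v) w = basis_vec K (u @ v) w" .
qed

lemma assoc_algebra_free_algebra: "assoc_algebra K FA"
  by (rule FA.assoc_algebra_basisI)
    (auto simp: free_algebra_mult_bilinear free_algebra_mult_basis free_algebra_one FA.basis_vec_closed)

end

definition word_value :: "('a, 'v) ring_scheme \<Rightarrow> ('x \<Rightarrow> 'a) \<Rightarrow> 'x list \<Rightarrow> 'a"
  where "word_value B \<phi> w = foldr (\<lambda>x a. \<phi> x \<otimes>\<^bsub>B\<^esub> a) w \<one>\<^bsub>B\<^esub>"

definition free_algebra_lift ::
  "('k, 'u) ring_scheme \<Rightarrow> ('k, 'b, 'v) module_scheme \<Rightarrow> ('x \<Rightarrow> 'b) \<Rightarrow> ('x list \<Rightarrow> 'k) \<Rightarrow> 'b"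
  where "free_algebra_lift K B \<phi> = linear_ext K B (word_value B \<phi>)"

context free_alg begin

context
  fixes B :: "('k, 'b, 'v) module_scheme" and \<phi>
  assumes B: "assoc_algebra K B" and \<phi>: "\<And>x. x \<in> X \<Longrightarrow> \<phi> x \<in> carrier B"
begin

lemma word_value_closed: "w \<in> lists X \<Longrightarrow> word_value B \<phi> w \<in> carrier B"
proof -
  interpret B: assoc_algebra K B by (rule B)
  show "w \<in> lists X \<Longrightarrow> word_value B \<phi> w \<in> carrier B"
    by (induction w) (auto simp: word_value_def \<phi>)
qed

lemma word_value_append:
  "\<lbrakk>u \<in> lists X; v \<in> lists X\<rbrakk> \<Longrightarrow> word_value B \<phi> (u @ v) = word_value B \<phi> u \<otimes>\<^bsub>B\<^esub> word_value B \<phi> v"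
proof -
  interpret B: assoc_algebra K B by (rule B)
  show "\<lbrakk>u \<in> lists X; v \<in> lists X\<rbrakk> \<Longrightarrow> ?thesis"
  proof (induction u)
    case Nil
    then show ?case using word_value_closed[of v] by (simp add: word_value_def)
  next
    case (Cons x u)
    have "word_value B \<phi> (x # w) = \<phi> x \<otimes>\<^bsub>B\<^esub> word_value B \<phi> w" for w
      by (simp add: word_value_def)
    with Cons show ?case
      using word_value_closed by (simp add: B.m_assoc \<phi>)
  qed
qed

lemma free_algebra_lift_basis:
  "w \<in> lists X \<Longrightarrow> free_algebra_lift K B \<phi> (basis_vec K w) = word_value B \<phi> w"
  unfolding free_algebra_lift_def
  by (rule FA.linear_ext_basis[OF assoc_algebra.module_K[OF B] word_value_closed])

text \<open>Universal property of the free algebra: on words multiplicativity is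
  \<open>word_value_append\<close>, and basis vectors suffice.\<close>

lemma free_algebra_lift_hom: "free_algebra_lift K B \<phi> \<in> algebra_homs K FA B"
proof (rule FA.algebra_hom_basisI[OF assoc_algebra_free_algebra B])
  show "free_algebra_lift K B \<phi> \<in> linear_maps K FA B"
    unfolding free_algebra_lift_def
    by (rule FA.linear_ext_linear[OF assoc_algebra.module_K[OF B] word_value_closed])
  show "free_algebra_lift K B \<phi> \<one>\<^bsub>FA\<^esub> = \<one>\<^bsub>B\<^esub>"
    using free_algebra_lift_basis[of "[]"] by (simp add: free_algebra_one word_value_def)
qed (use word_value_append in \<open>auto simp: free_algebra_mult_basis free_algebra_lift_basis\<close>)

lemma free_algebra_lift_generator:
  assumes "x \<in> X"
  shows "free_algebra_lift K B \<phi> (basis_vec K [x]) = \<phi> x"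
proof -
  interpret B: assoc_algebra K B by (rule B)
  show ?thesis using assms \<phi> by (simp add: free_algebra_lift_basis word_value_def)
qed

end

end

text \<open>Polynomials of the library are sequences vanishing beyond a bound. Over the natural
  numbers this means finite support, so k[Q] is free on the powers of Q.\<close>

lemma finsupp_module_UP:
  assumes "cring K"
  shows "finsupp_module K UNIV (UP K)"
proof -
  interpret cring K by fact
  have "up K = finsupp K UNIV"
  proof (intro Set.set_eqI)
    fix p :: "nat \<Rightarrow> 'a"
    have "finite {i. p i \<noteq> \<zero>\<^bsub>K\<^esub>} \<longleftrightarrow> (\<exists>n. bound \<zero>\<^bsub>K\<^esub> n p)"
      unfolding bound_def finite_nat_set_iff_bounded_le by (metis (mono_tags, lifting) mem_Collect_eq not_le)
    then show "p \<in> up K \<longleftrightarrow> p \<in> finsupp K UNIV"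
      by (auto simp: up_def finsupp_def)
  qed
  then show ?thesis
    by (intro finsupp_module.intro finsupp_module_axioms.intro is_cring) (auto simp: UP_def)
qed

locale up_alg = cring K for K :: "('k, 'u) ring_scheme" (structure)
begin

sublocale UPC: UP_cring K "UP K"
  by (intro UP_cring.intro is_cring)

sublocale UPF: finsupp_module K UNIV "UP K"
  by (rule finsupp_module_UP[OF is_cring])

lemma basis_vec_monom: "basis_vec K i = monom (UP K) \<one> i"
  by (auto simp: basis_vec_def UP_def)

lemma UP_mult_basis: "basis_vec K i \<otimes>\<^bsub>UP K\<^esub> basis_vec K j = basis_vec K (i + j)"
  using UPC.monom_mult[of \<one> \<one> i j] by (simp add: basis_vec_monom)

lemma UP_one_basis: "\<one>\<^bsub>UP K\<^esub> = basis_vec K 0"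
  by (auto simp: basis_vec_def UP_def)

lemma UP_assoc_algebra: "assoc_algebra K (UP K)"
  by (intro assoc_algebra.intro assoc_algebra_axioms.intro UPF.finsupp_is_module UPC.UP_ring)
    (use UPC.UP_smult_assoc2 UPC.UP_m_comm UPC.UP_smult_closed in metis)+

context
  fixes B :: "('k, 'b, 'v) module_scheme" and q
  assumes B: "assoc_algebra K B" and q: "q \<in> carrier B"
begin

lemma UP_lift_basis: "linear_ext K B (\<lambda>i::nat. q [^]\<^bsub>B\<^esub> i) (basis_vec K i) = q [^]\<^bsub>B\<^esub> i"
proof -
  interpret B: assoc_algebra K B by (rule B)
  show ?thesis by (intro UPF.linear_ext_basis B.module_K) (auto simp: q)
qed

text \<open>Evaluation at q is multiplicative even into a noncommutative B, since powers of a single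
  element multiply by adding exponents.\<close>

lemma UP_lift_hom: "linear_ext K B (\<lambda>i::nat. q [^]\<^bsub>B\<^esub> i) \<in> algebra_homs K (UP K) B"
proof -
  interpret B: assoc_algebra K B by (rule B)
  show ?thesis
    by (intro UPF.algebra_hom_basisI UP_assoc_algebra B UPF.linear_ext_linear B.module_K)
      (auto simp: q UP_lift_basis UP_one_basis UP_mult_basis B.nat_pow_mult)
qed

lemma UP_lift_X: "linear_ext K B (\<lambda>i::nat. q [^]\<^bsub>B\<^esub> i) (monom (UP K) \<one> 1) = q"
proof -
  interpret B: assoc_algebra K B by (rule B)
  show ?thesis using UP_lift_basis[of 1] q by (simp add: basis_vec_monom)
qed

end

end

section \<open>The algebra structure on the direct sum\<close>

context rota_baxter_algebra begin

sublocale TT: tensor K R R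
  by (intro tensor.intro module_axioms)

abbreviation "T \<equiv> tensor_product K R R"
abbreviation "pt \<equiv> pure_tensor K R R"
abbreviation "P' \<equiv> P_tilde K R P lam"
abbreviation "lm \<equiv> tensor_lmult K R"
abbreviation "rm \<equiv> tensor_rmult K R"
abbreviation "tm \<equiv> tensor_mult K R P lam"
abbreviation "S \<equiv> rb_sum_algebra K R P lam"

lemma P_linear: "P \<in> linear_maps K R R"
  by (intro linear_mapsI P_closed P_add P_smult)

lemma P_tilde_eq: "x \<in> carrier R \<Longrightarrow> P' x = \<ominus>\<^bsub>R\<^esub> (lam \<odot>\<^bsub>R\<^esub> x) \<oplus>\<^bsub>R\<^esub> \<ominus>\<^bsub>R\<^esub> P x"
  by (simp add: P_tilde_def smult_l_minus weight_closed a_minus_def)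

lemma P_uminus: "x \<in> carrier R \<Longrightarrow> P (\<ominus>\<^bsub>R\<^esub> x) = \<ominus>\<^bsub>R\<^esub> P x"
  by (rule linear_map_uminus[OF module_K module_K P_linear])

lemma P_tilde_linear: "P' \<in> linear_maps K R R"
proof -
  have "(\<lambda>x. (\<ominus> lam) \<odot>\<^bsub>R\<^esub> x \<oplus>\<^bsub>R\<^esub> (\<ominus> \<one>) \<odot>\<^bsub>R\<^esub> P x) \<in> linear_maps K R R"
    by (intro linear_maps_add linear_maps_smult P_linear module_K)
      (auto simp: weight_closed intro: linear_mapsI)
  then show ?thesis
    by (rule linear_maps_cong[rotated]) (auto simp: P_tilde_def a_minus_def smult_l_minus P_closed module_K)
qed

lemmas P_tilde_simps = linear_mapsD[OF P_tilde_linear]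

text \<open>Expanding \<open>P'\<close> in P(P'(a) b) gives -lam P(ab) - P(P(a) b), which cancels
  two of the three terms of the Rota-Baxter identity for P(a) P(b). In the second identity
  everything is expanded and P(a) P(b) is replaced by its three terms.\<close>

lemma rota_baxter_P_tilde:
  assumes "a \<in> carrier R" "b \<in> carrier R"
  shows "P a \<otimes>\<^bsub>R\<^esub> P b \<oplus>\<^bsub>R\<^esub> P (P' a \<otimes>\<^bsub>R\<^esub> b) = P (a \<otimes>\<^bsub>R\<^esub> P b)"
    and "P' (a \<otimes>\<^bsub>R\<^esub> P b) \<oplus>\<^bsub>R\<^esub> P' a \<otimes>\<^bsub>R\<^esub> P' b = P' (P' a \<otimes>\<^bsub>R\<^esub> b)"
proof -
  note c = assms weight_closed P_closed
  have "P (P' a \<otimes>\<^bsub>R\<^esub> b) = \<ominus>\<^bsub>R\<^esub> (lam \<odot>\<^bsub>R\<^esub> P (a \<otimes>\<^bsub>R\<^esub> b)) \<oplus>\<^bsub>R\<^esub> \<ominus>\<^bsub>R\<^esub> P (P a \<otimes>\<^bsub>R\<^esub> b)"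
    by (simp add: P_tilde_eq c l_distr l_minus P_add P_uminus smult_mult_left P_smult)
  note expand = this
  show "P a \<otimes>\<^bsub>R\<^esub> P b \<oplus>\<^bsub>R\<^esub> P (P' a \<otimes>\<^bsub>R\<^esub> b) = P (a \<otimes>\<^bsub>R\<^esub> P b)"
    unfolding expand rota_baxter[OF assms]
    using c by (simp add: M.a_ac M.r_neg M.r_neg1 M.r_neg2)
  \<comment> \<open>To be read with u = lam a P(b), v = P(a P(b)), w = lam^2 ab, x = lam P(a) b, y =
    P(P(a) b), z = lam P(ab): the terms u and v of \<open>P' (a P(b))\<close> cancel against the
    product of the two \<open>P'\<close> values.\<close>
  have cancel: "(\<ominus>\<^bsub>R\<^esub> u \<oplus>\<^bsub>R\<^esub> \<ominus>\<^bsub>R\<^esub> v) \<oplus>\<^bsub>R\<^esub> (w \<oplus>\<^bsub>R\<^esub> u \<oplus>\<^bsub>R\<^esub> (x \<oplus>\<^bsub>R\<^esub> (v \<oplus>\<^bsub>R\<^esub> y \<oplus>\<^bsub>R\<^esub> z)))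
      = w \<oplus>\<^bsub>R\<^esub> x \<oplus>\<^bsub>R\<^esub> (z \<oplus>\<^bsub>R\<^esub> y)"
    if "u \<in> carrier R" "v \<in> carrier R" "w \<in> carrier R" "x \<in> carrier R" "y \<in> carrier R" "z \<in> carrier R"
    for u v w x y z
  proof -
    have "w \<oplus>\<^bsub>R\<^esub> u \<oplus>\<^bsub>R\<^esub> (x \<oplus>\<^bsub>R\<^esub> (v \<oplus>\<^bsub>R\<^esub> y \<oplus>\<^bsub>R\<^esub> z)) = (u \<oplus>\<^bsub>R\<^esub> v) \<oplus>\<^bsub>R\<^esub> (w \<oplus>\<^bsub>R\<^esub> x \<oplus>\<^bsub>R\<^esub> (z \<oplus>\<^bsub>R\<^esub> y))"
      using that by (simp add: M.a_ac)
    moreover have "\<ominus>\<^bsub>R\<^esub> u \<oplus>\<^bsub>R\<^esub> \<ominus>\<^bsub>R\<^esub> v = \<ominus>\<^bsub>R\<^esub> (u \<oplus>\<^bsub>R\<^esub> v)"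
      using that by (simp add: M.minus_add)
    ultimately show ?thesis
      using that M.r_neg1[of "u \<oplus>\<^bsub>R\<^esub> v"] by simp
  qed
  have "P' (P' a \<otimes>\<^bsub>R\<^esub> b) =
    lam \<odot>\<^bsub>R\<^esub> (lam \<odot>\<^bsub>R\<^esub> (a \<otimes>\<^bsub>R\<^esub> b)) \<oplus>\<^bsub>R\<^esub> lam \<odot>\<^bsub>R\<^esub> (P a \<otimes>\<^bsub>R\<^esub> b)
      \<oplus>\<^bsub>R\<^esub> (lam \<odot>\<^bsub>R\<^esub> P (a \<otimes>\<^bsub>R\<^esub> b) \<oplus>\<^bsub>R\<^esub> P (P a \<otimes>\<^bsub>R\<^esub> b))"
    using P_tilde_simps(1)
    by (simp add: P_tilde_eq[of "P' a \<otimes>\<^bsub>R\<^esub> b"] expand c M.minus_add)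
      (simp add: P_tilde_eq c l_distr l_minus smult_mult_left smult_r_distr smult_r_minus M.minus_add)
  moreover have "P' a \<otimes>\<^bsub>R\<^esub> P' b =
    lam \<odot>\<^bsub>R\<^esub> (lam \<odot>\<^bsub>R\<^esub> (a \<otimes>\<^bsub>R\<^esub> b)) \<oplus>\<^bsub>R\<^esub> lam \<odot>\<^bsub>R\<^esub> (a \<otimes>\<^bsub>R\<^esub> P b)
      \<oplus>\<^bsub>R\<^esub> (lam \<odot>\<^bsub>R\<^esub> (P a \<otimes>\<^bsub>R\<^esub> b) \<oplus>\<^bsub>R\<^esub> P a \<otimes>\<^bsub>R\<^esub> P b)"
    by (simp add: P_tilde_eq c l_distr r_distr l_minus r_minus smult_mult_left smult_mult_right
        smult_r_distr smult_r_minus M.minus_add M.a_ac)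
  moreover have "P' (a \<otimes>\<^bsub>R\<^esub> P b) = \<ominus>\<^bsub>R\<^esub> (lam \<odot>\<^bsub>R\<^esub> (a \<otimes>\<^bsub>R\<^esub> P b)) \<oplus>\<^bsub>R\<^esub> \<ominus>\<^bsub>R\<^esub> P (a \<otimes>\<^bsub>R\<^esub> P b)"
    by (simp add: P_tilde_eq c)
  ultimately show "P' (a \<otimes>\<^bsub>R\<^esub> P b) \<oplus>\<^bsub>R\<^esub> P' a \<otimes>\<^bsub>R\<^esub> P' b = P' (P' a \<otimes>\<^bsub>R\<^esub> b)"
    using c by (simp only: rota_baxter[OF assms] cancel m_closed smult_closed P_closed)
qed

lemmas tensor_simps = TT.pure_tensor_simps linear_mapsD[OF P_linear] P_tilde_simps l_distr r_distr smult_mult_left smult_mult_right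
  TT.T.smult_r_distr

section \<open>The bimodule structure and the product on R tensor R\<close>

lemma lmult_bilinear: "lm \<in> bilinear_maps K R T T"
  and lmult_pure: "\<lbrakk>r \<in> carrier R; a \<in> carrier R; b \<in> carrier R\<rbrakk> \<Longrightarrow> lm r (pt a b) = pt (r \<otimes>\<^bsub>R\<^esub> a) b"
proof -
  have bil: "(\<lambda>r1 s1. pt (r \<otimes>\<^bsub>R\<^esub> r1) s1) \<in> bilinear_maps K R R T" if "r \<in> carrier R" for r
    using that by (intro bilinear_mapsI linear_mapsI) (simp_all add: tensor_simps)
  show "lm \<in> bilinear_maps K R T T"
    unfolding tensor_lmult_def[abs_def]
    by (rule TT.tensor_lift_bilinear[OF TT.module_T module_K bil])
      (auto intro!: linear_mapsI simp: tensor_simps)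
  show "\<lbrakk>r \<in> carrier R; a \<in> carrier R; b \<in> carrier R\<rbrakk> \<Longrightarrow> lm r (pt a b) = pt (r \<otimes>\<^bsub>R\<^esub> a) b"
    by (simp add: tensor_lmult_def TT.tensor_lift_pure[OF TT.module_T bil])
qed

text \<open>The arguments are swapped because \<open>tensor_lift_bilinear\<close> expects the
  parameter before the tensor on which the lift acts.\<close>

lemma rmult_bilinear: "(\<lambda>s X. rm X s) \<in> bilinear_maps K R T T"
  and rmult_pure: "\<lbrakk>s \<in> carrier R; a \<in> carrier R; b \<in> carrier R\<rbrakk> \<Longrightarrow> rm (pt a b) s = pt a (b \<otimes>\<^bsub>R\<^esub> s)"
proof -
  have bil: "(\<lambda>r1 s1. pt r1 (s1 \<otimes>\<^bsub>R\<^esub> s)) \<in> bilinear_maps K R R T" if "s \<in> carrier R" for s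
    using that by (intro bilinear_mapsI linear_mapsI) (simp_all add: tensor_simps)
  show "(\<lambda>s X. rm X s) \<in> bilinear_maps K R T T"
    unfolding tensor_rmult_def[abs_def]
    by (rule TT.tensor_lift_bilinear[OF TT.module_T module_K bil])
      (auto intro!: linear_mapsI simp: tensor_simps)
  show "\<lbrakk>s \<in> carrier R; a \<in> carrier R; b \<in> carrier R\<rbrakk> \<Longrightarrow> rm (pt a b) s = pt a (b \<otimes>\<^bsub>R\<^esub> s)"
    by (simp add: tensor_rmult_def TT.tensor_lift_pure[OF TT.module_T bil])
qed

text \<open>The outer lift runs over X with Y as parameter. It needs bilinearity in (r1, s1) for
  fixed Y and, on pure tensors, linearity in Y; both come from the inner lift.\<close>

lemma tmult_bilinear: "(\<lambda>Y X. tm X Y) \<in> bilinear_maps K T T T"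
  and tmult_pure: "\<lbrakk>a \<in> carrier R; b \<in> carrier R; c \<in> carrier R; d \<in> carrier R\<rbrakk> \<Longrightarrow>
    tm (pt a b) (pt c d) =
      pt (a \<otimes>\<^bsub>R\<^esub> P (b \<otimes>\<^bsub>R\<^esub> c)) d \<oplus>\<^bsub>T\<^esub> pt a (P' (b \<otimes>\<^bsub>R\<^esub> c) \<otimes>\<^bsub>R\<^esub> d)"
proof -
  let ?\<beta> = "\<lambda>r1 s1 r2 s2. pt (r1 \<otimes>\<^bsub>R\<^esub> P (s1 \<otimes>\<^bsub>R\<^esub> r2)) s2 \<oplus>\<^bsub>T\<^esub> pt r1 (P' (s1 \<otimes>\<^bsub>R\<^esub> r2) \<otimes>\<^bsub>R\<^esub> s2)"
  have \<beta>: "?\<beta> r1 s1 \<in> bilinear_maps K R R T" if "r1 \<in> carrier R" "s1 \<in> carrier R" for r1 s1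
    using that by (intro bilinear_mapsI linear_mapsI) (simp_all add: tensor_simps TT.T.a_ac)
  have r1: "(\<lambda>r1. tensor_lift K T (?\<beta> r1 s1)) \<in> bilinear_maps K R T T" if "s1 \<in> carrier R" for s1
    using that
    by (intro TT.tensor_lift_bilinear TT.module_T module_K \<beta> linear_mapsI)
      (auto simp: tensor_simps TT.T.a_ac)
  have s1: "(\<lambda>s1. tensor_lift K T (?\<beta> r1 s1)) \<in> bilinear_maps K R T T" if "r1 \<in> carrier R" for r1
    using that
    by (intro TT.tensor_lift_bilinear TT.module_T module_K \<beta> linear_mapsI)
      (auto simp: tensor_simps TT.T.a_ac)
  \<comment> \<open>\<open>r1\<close> and \<open>s1\<close> treat the inner lift as jointly bilinear
    in one component and Y; fixing Y leaves linearity in each component.\<close>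
  have \<gamma>: "(\<lambda>r1 s1. tensor_lift K T (?\<beta> r1 s1) Y) \<in> bilinear_maps K R R T" if "Y \<in> carrier T" for Y
    using that by (intro bilinear_mapsI bilinear_maps_left[OF r1] bilinear_maps_left[OF s1])
  show "(\<lambda>Y X. tm X Y) \<in> bilinear_maps K T T T"
    unfolding tensor_mult_def[abs_def] Let_def
    by (rule TT.tensor_lift_bilinear[OF TT.module_T TT.module_T \<gamma> bilinear_maps_right[OF r1]])
  show "\<lbrakk>a \<in> carrier R; b \<in> carrier R; c \<in> carrier R; d \<in> carrier R\<rbrakk> \<Longrightarrow>
    tm (pt a b) (pt c d) =
      pt (a \<otimes>\<^bsub>R\<^esub> P (b \<otimes>\<^bsub>R\<^esub> c)) d \<oplus>\<^bsub>T\<^esub> pt a (P' (b \<otimes>\<^bsub>R\<^esub> c) \<otimes>\<^bsub>R\<^esub> d)"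
    unfolding tensor_mult_def Let_def
    by (subst TT.tensor_lift_pure[OF TT.module_T \<gamma>])
      (simp_all add: tensor_simps TT.tensor_lift_pure[OF TT.module_T \<beta>])
qed

lemmas lmult_simps = bilinear_mapsD[OF lmult_bilinear] lmult_pure
  linear_map_zero[OF TT.module_T TT.module_T bilinear_maps_right[OF lmult_bilinear]]
  linear_map_zero[OF module_K TT.module_T bilinear_maps_left[OF lmult_bilinear]]
lemmas rmult_simps = bilinear_mapsD[OF rmult_bilinear] rmult_pure
  linear_map_zero[OF TT.module_T TT.module_T bilinear_maps_right[OF rmult_bilinear]]
  linear_map_zero[OF module_K TT.module_T bilinear_maps_left[OF rmult_bilinear]]
lemmas tmult_simps = bilinear_mapsD[OF tmult_bilinear] tmult_pure
  linear_map_zero[OF TT.module_T TT.module_T bilinear_maps_right[OF tmult_bilinear]]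
  linear_map_zero[OF TT.module_T TT.module_T bilinear_maps_left[OF tmult_bilinear]]

lemma tensor_actions:
  assumes X: "X \<in> carrier T" and r: "r \<in> carrier R" "s \<in> carrier R"
  shows "lm (r \<otimes>\<^bsub>R\<^esub> s) X = lm r (lm s X)" "rm (lm r X) s = lm r (rm X s)"
    "rm (rm X r) s = rm X (r \<otimes>\<^bsub>R\<^esub> s)" "lm \<one>\<^bsub>R\<^esub> X = X" "rm X \<one>\<^bsub>R\<^esub> = X"
  using X by (induction X rule: TT.tensor_induct; simp add: r lmult_simps rmult_simps TT.pure_tensor_simps m_assoc)+

text \<open>The outer factors of a product of pure tensors are only multiplied from outside, and the
  inner ones occur only through their product, so s may be passed across the middle. A pure left
  factor keeps this a single induction; \<open>tensor_mult_actions\<close> then releases it.\<close>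

lemma tensor_mult_actions_pure:
  assumes "Y \<in> carrier T" "a \<in> carrier R" "b \<in> carrier R" "s \<in> carrier R"
  shows "rm (tm (pt a b) Y) s = tm (pt a b) (rm Y s)"
    "tm (pt (s \<otimes>\<^bsub>R\<^esub> a) b) Y = lm s (tm (pt a b) Y)"
    "tm (pt a (b \<otimes>\<^bsub>R\<^esub> s)) Y = tm (pt a b) (lm s Y)"
  using assms
  by (induction Y rule: TT.tensor_induct; simp add: lmult_simps rmult_simps tmult_simps TT.pure_tensor_simps P_tilde_simps P_closed m_assoc)+

lemma tensor_mult_actions:
  assumes "X \<in> carrier T" "Y \<in> carrier T" "s \<in> carrier R"
  shows "rm (tm X Y) s = tm X (rm Y s)" "tm (lm s X) Y = lm s (tm X Y)"
    "tm (rm X s) Y = tm X (lm s Y)"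
  using assms
  by (induction X rule: TT.tensor_induct; simp add: lmult_simps rmult_simps tmult_simps TT.pure_tensor_simps tensor_mult_actions_pure)+

text \<open>Both bracketings share the term r1 P(a) tensor P'(b) s3. The others match by the two
  identities of \<open>rota_baxter_P_tilde\<close>: the first merges two terms in the left tensor
  factor, the second splits one in the right factor.\<close>

lemma tensor_mult_assoc_pure:
  assumes r: "r1 \<in> carrier R" "s1 \<in> carrier R" "r2 \<in> carrier R" "s2 \<in> carrier R" "r3 \<in> carrier R" "s3 \<in> carrier R"
  shows "tm (tm (pt r1 s1) (pt r2 s2)) (pt r3 s3) = tm (pt r1 s1) (tm (pt r2 s2) (pt r3 s3))"
proof -
  define a b where ab: "a = s1 \<otimes>\<^bsub>R\<^esub> r2" "b = s2 \<otimes>\<^bsub>R\<^esub> r3"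
  have c: "a \<in> carrier R" "b \<in> carrier R" using r by (simp_all add: ab)
  note cc = r c P_closed P_tilde_simps(1) TT.pure_tensor_simps(1)
  have "tm (tm (pt r1 s1) (pt r2 s2)) (pt r3 s3) =
     pt (r1 \<otimes>\<^bsub>R\<^esub> P a \<otimes>\<^bsub>R\<^esub> P b) s3 \<oplus>\<^bsub>T\<^esub> pt (r1 \<otimes>\<^bsub>R\<^esub> P a) (P' b \<otimes>\<^bsub>R\<^esub> s3)
     \<oplus>\<^bsub>T\<^esub> (pt (r1 \<otimes>\<^bsub>R\<^esub> P (P' a \<otimes>\<^bsub>R\<^esub> b)) s3 \<oplus>\<^bsub>T\<^esub> pt r1 (P' (P' a \<otimes>\<^bsub>R\<^esub> b) \<otimes>\<^bsub>R\<^esub> s3))"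
    using cc by (simp add: tmult_simps m_assoc flip: ab)
  also have "\<dots> = pt (r1 \<otimes>\<^bsub>R\<^esub> (P a \<otimes>\<^bsub>R\<^esub> P b \<oplus>\<^bsub>R\<^esub> P (P' a \<otimes>\<^bsub>R\<^esub> b))) s3
     \<oplus>\<^bsub>T\<^esub> (pt (r1 \<otimes>\<^bsub>R\<^esub> P a) (P' b \<otimes>\<^bsub>R\<^esub> s3) \<oplus>\<^bsub>T\<^esub> pt r1 (P' (P' a \<otimes>\<^bsub>R\<^esub> b) \<otimes>\<^bsub>R\<^esub> s3))"
    using cc by (simp add: r_distr TT.pure_tensor_simps(2) m_assoc TT.T.a_ac)
  also have "\<dots> = pt (r1 \<otimes>\<^bsub>R\<^esub> P (a \<otimes>\<^bsub>R\<^esub> P b)) s3 \<oplus>\<^bsub>T\<^esub> pt r1 (P' (a \<otimes>\<^bsub>R\<^esub> P b) \<otimes>\<^bsub>R\<^esub> s3)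
     \<oplus>\<^bsub>T\<^esub> (pt (r1 \<otimes>\<^bsub>R\<^esub> P a) (P' b \<otimes>\<^bsub>R\<^esub> s3) \<oplus>\<^bsub>T\<^esub> pt r1 (P' a \<otimes>\<^bsub>R\<^esub> P' b \<otimes>\<^bsub>R\<^esub> s3))"
    using cc rota_baxter_P_tilde[OF c]
    by (simp add: l_distr TT.pure_tensor_simps(3) TT.T.a_ac flip: rota_baxter_P_tilde(2)[OF c])
  also have "\<dots> = tm (pt r1 s1) (tm (pt r2 s2) (pt r3 s3))"
    \<comment> \<open>The right bracketing produces s1 (r2 P(b)), which must be regrouped before a =
      s1 r2 becomes visible; hence the second pass with \<open>ab\<close> unfolded.\<close>
    using cc by (simp add: tmult_simps m_assoc flip: ab) (simp add: ab m_assoc[symmetric])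
  finally show ?thesis .
qed

text \<open>Arguments are generalized from pure tensors in the order Z, Y, X. The rule
  \<open>tmult_pure\<close> is withheld in \<open>1\<close> and \<open>2\<close>, so that products
  of pure tensors stay intact and match the preceding case.\<close>

lemma tensor_mult_assoc:
  assumes "X \<in> carrier T" "Y \<in> carrier T" "Z \<in> carrier T"
  shows "tm (tm X Y) Z = tm X (tm Y Z)"
proof -
  have 1: "tm (tm (pt a b) (pt c d)) Z = tm (pt a b) (tm (pt c d) Z)"
    if "Z \<in> carrier T" "a \<in> carrier R" "b \<in> carrier R" "c \<in> carrier R" "d \<in> carrier R" for Z a b c d
    using that by (induction Z rule: TT.tensor_induct) (simp_all add: tmult_simps TT.pure_tensor_simps(1) tensor_mult_assoc_pure del: tmult_pure)
  have 2: "tm (tm (pt a b) Y) Z = tm (pt a b) (tm Y Z)"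
    if "Y \<in> carrier T" "Z \<in> carrier T" "a \<in> carrier R" "b \<in> carrier R" for Y Z a b
    using that by (induction Y rule: TT.tensor_induct) (simp_all add: tmult_simps(1-5,7,8) TT.pure_tensor_simps(1) 1)
  show ?thesis
    using assms by (induction X rule: TT.tensor_induct) (simp_all add: tmult_simps TT.pure_tensor_simps(1) 2)
qed

lemma sum_algebra_simps:
  "carrier S = carrier R \<times> carrier T"
  "(r, X) \<otimes>\<^bsub>S\<^esub> (s, Y) = (r \<otimes>\<^bsub>R\<^esub> s, lm r Y \<oplus>\<^bsub>T\<^esub> rm X s \<oplus>\<^bsub>T\<^esub> tm X Y)"
  "\<one>\<^bsub>S\<^esub> = (\<one>\<^bsub>R\<^esub>, \<zero>\<^bsub>T\<^esub>)"
  "\<zero>\<^bsub>S\<^esub> = (\<zero>\<^bsub>R\<^esub>, \<zero>\<^bsub>T\<^esub>)"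
  "(r, X) \<oplus>\<^bsub>S\<^esub> (s, Y) = (r \<oplus>\<^bsub>R\<^esub> s, X \<oplus>\<^bsub>T\<^esub> Y)"
  "c \<odot>\<^bsub>S\<^esub> (r, X) = (c \<odot>\<^bsub>R\<^esub> r, c \<odot>\<^bsub>T\<^esub> X)"
  by (simp_all add: rb_sum_algebra_def Let_def)

lemma module_sum_algebra: "module K S"
proof (rule moduleI)
  have "\<exists>y\<in>carrier S. y \<oplus>\<^bsub>S\<^esub> x = \<zero>\<^bsub>S\<^esub>" if "x \<in> carrier S" for x
    using that
    by (intro bexI[of _ "(\<ominus>\<^bsub>R\<^esub> fst x, \<ominus>\<^bsub>T\<^esub> snd x)"]) (auto simp: sum_algebra_simps M.l_neg TT.T.l_neg)
  then show "abelian_group S"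
    by (intro abelian_groupI) (auto simp: sum_algebra_simps M.a_ac TT.T.a_ac)
qed (auto simp: sum_algebra_simps smult_l_distr smult_r_distr smult_assoc1 TT.T.smult_l_distr
    TT.T.smult_r_distr TT.T.smult_assoc1 R.is_cring)

text \<open>A triple product splits into eight cases by the summand of each factor: associativity in
  R, three bimodule laws, three compatibilities of the actions with the product of tensors, and
  associativity on R tensor R.\<close>

lemma assoc_algebra_sum_algebra: "assoc_algebra K S"
proof (rule assoc_algebraI[OF module_sum_algebra])
  show "mult S \<in> bilinear_maps K S S S"
    by (intro bilinear_mapsI linear_mapsI)
      (auto simp: sum_algebra_simps lmult_simps(1-5) rmult_simps(1-5) tmult_simps(1-5) l_distr r_distr smult_mult_left smult_mult_right
        TT.T.smult_r_distr TT.T.a_ac)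
  show "x \<otimes>\<^bsub>S\<^esub> y \<otimes>\<^bsub>S\<^esub> z = x \<otimes>\<^bsub>S\<^esub> (y \<otimes>\<^bsub>S\<^esub> z)"
    if "x \<in> carrier S" "y \<in> carrier S" "z \<in> carrier S" for x y z
    using that
    by (auto simp: sum_algebra_simps lmult_simps(1-5) rmult_simps(1-5) tmult_simps(1-5) m_assoc tensor_actions(1-3)
        tensor_mult_actions tensor_mult_assoc TT.T.a_ac)
qed (auto simp: sum_algebra_simps lmult_simps rmult_simps tmult_simps tensor_actions)

end

section \<open>The isomorphism\<close>

context rota_baxter_algebra begin

text \<open>Stated for an arbitrary target B because it is used in both directions: in the quotient
  it extracts the two-term rule from the vanishing relation, and in the direct sum it derives the
  vanishing from the two-term rule.\<close>

lemma rb_relation_iff: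
  assumes B: "assoc_algebra K B" and a: "a \<in> algebra_homs K R B"
    and q: "q \<in> carrier B" and r: "r \<in> carrier R"
  shows "q \<otimes>\<^bsub>B\<^esub> a r \<otimes>\<^bsub>B\<^esub> q \<ominus>\<^bsub>B\<^esub> a (P r) \<otimes>\<^bsub>B\<^esub> q \<oplus>\<^bsub>B\<^esub> q \<otimes>\<^bsub>B\<^esub> a (P r) \<oplus>\<^bsub>B\<^esub> lam \<odot>\<^bsub>B\<^esub> (q \<otimes>\<^bsub>B\<^esub> a r) = \<zero>\<^bsub>B\<^esub>
    \<longleftrightarrow> q \<otimes>\<^bsub>B\<^esub> a r \<otimes>\<^bsub>B\<^esub> q = a (P r) \<otimes>\<^bsub>B\<^esub> q \<oplus>\<^bsub>B\<^esub> q \<otimes>\<^bsub>B\<^esub> a (P' r)"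
proof -
  interpret B: assoc_algebra K B by (rule B)
  note A = linear_mapsD[OF algebra_homsD(1)[OF a]]
  have u: "a (\<ominus>\<^bsub>R\<^esub> x) = \<ominus>\<^bsub>B\<^esub> a x" if "x \<in> carrier R" for x
    using that by (rule linear_map_uminus[OF module_K B.module_K algebra_homsD(1)[OF a]])
  have "q \<otimes>\<^bsub>B\<^esub> a (P' r) = \<ominus>\<^bsub>B\<^esub> (lam \<odot>\<^bsub>B\<^esub> (q \<otimes>\<^bsub>B\<^esub> a r)) \<oplus>\<^bsub>B\<^esub> \<ominus>\<^bsub>B\<^esub> (q \<otimes>\<^bsub>B\<^esub> a (P r))"
    using q r by (simp add: P_tilde_eq A P_closed weight_closed u B.r_distr B.r_minus B.smult_mult_right)
  moreover have "x \<ominus>\<^bsub>B\<^esub> y \<oplus>\<^bsub>B\<^esub> z \<oplus>\<^bsub>B\<^esub> w = \<zero>\<^bsub>B\<^esub> \<longleftrightarrow> x = y \<oplus>\<^bsub>B\<^esub> (\<ominus>\<^bsub>B\<^esub> w \<oplus>\<^bsub>B\<^esub> \<ominus>\<^bsub>B\<^esub> z)"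
    if "x \<in> carrier B" "y \<in> carrier B" "z \<in> carrier B" "w \<in> carrier B" for x y z w
  proof -
    have "x \<ominus>\<^bsub>B\<^esub> y \<oplus>\<^bsub>B\<^esub> z \<oplus>\<^bsub>B\<^esub> w = x \<ominus>\<^bsub>B\<^esub> (y \<oplus>\<^bsub>B\<^esub> (\<ominus>\<^bsub>B\<^esub> w \<oplus>\<^bsub>B\<^esub> \<ominus>\<^bsub>B\<^esub> z))"
      using that by (simp add: a_minus_def B.minus_add B.a_ac)
    then show ?thesis
      using that by (simp add: B.minus_eq_zero_iff)
  qed
  ultimately show ?thesis
    using q r by (simp add: A P_closed weight_closed)
qed

lemma sum_algebra_inl: "(\<lambda>r. (r, \<zero>\<^bsub>T\<^esub>)) \<in> algebra_homs K R S"
  by (intro algebra_homsI linear_mapsI) (simp_all add: sum_algebra_simps lmult_simps rmult_simps tmult_simps)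

lemma sum_algebra_q_relation:
  assumes "r \<in> carrier R"
  shows "(\<zero>\<^bsub>R\<^esub>, pt \<one>\<^bsub>R\<^esub> \<one>\<^bsub>R\<^esub>) \<otimes>\<^bsub>S\<^esub> (r, \<zero>\<^bsub>T\<^esub>) \<otimes>\<^bsub>S\<^esub> (\<zero>\<^bsub>R\<^esub>, pt \<one>\<^bsub>R\<^esub> \<one>\<^bsub>R\<^esub>) =
    (P r, \<zero>\<^bsub>T\<^esub>) \<otimes>\<^bsub>S\<^esub> (\<zero>\<^bsub>R\<^esub>, pt \<one>\<^bsub>R\<^esub> \<one>\<^bsub>R\<^esub>) \<oplus>\<^bsub>S\<^esub> (\<zero>\<^bsub>R\<^esub>, pt \<one>\<^bsub>R\<^esub> \<one>\<^bsub>R\<^esub>) \<otimes>\<^bsub>S\<^esub> (P' r, \<zero>\<^bsub>T\<^esub>)"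
  using assms by (simp add: sum_algebra_simps lmult_simps rmult_simps tmult_simps TT.pure_tensor_simps(1) P_closed P_tilde_simps
      linear_map_zero[OF module_K TT.module_T bilinear_maps_left[OF TT.pure_tensor_bilinear]])

end

text \<open>Isolates what the argument uses about the ring of operators from its encoding as
  iterated quotients. \<open>generated\<close> asks for closure under left multiplication by
  generators only, so it applies to the image of g before that image is known to be a
  subalgebra.\<close>

locale rota_baxter_presentation = rota_baxter_algebra K R P lam + U: assoc_algebra K U
  for K :: "('k, 'u) ring_scheme" (structure) and R :: "('k, 'r, 'v) module_scheme" (structure)
    and P :: "'r \<Rightarrow> 'r" and lam :: 'k and U :: "('k, 'x, 'y) module_scheme" +
  fixes a :: "'r \<Rightarrow> 'x" and q :: 'x and h :: "'x \<Rightarrow> 'r \<times> ('r \<times> 'r \<Rightarrow> 'k) set"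
  assumes a: "a \<in> algebra_homs K R U" and q: "q \<in> carrier U"
    and qaq: "\<And>r. r \<in> carrier R \<Longrightarrow>
      q \<otimes>\<^bsub>U\<^esub> a r \<otimes>\<^bsub>U\<^esub> q = a (P r) \<otimes>\<^bsub>U\<^esub> q \<oplus>\<^bsub>U\<^esub> q \<otimes>\<^bsub>U\<^esub> a (P' r)"
    and generated: "\<And>V. \<lbrakk>submodule V K U; \<one>\<^bsub>U\<^esub> \<in> V;
        \<And>r v. \<lbrakk>r \<in> carrier R; v \<in> V\<rbrakk> \<Longrightarrow> a r \<otimes>\<^bsub>U\<^esub> v \<in> V; \<And>v. v \<in> V \<Longrightarrow> q \<otimes>\<^bsub>U\<^esub> v \<in> V\<rbrakk>
      \<Longrightarrow> carrier U \<subseteq> V"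
    and h: "h \<in> algebra_homs K U S"
    and ha: "\<And>r. r \<in> carrier R \<Longrightarrow> h (a r) = (r, \<zero>\<^bsub>T\<^esub>)"
    and hq: "h q = (\<zero>\<^bsub>R\<^esub>, pt \<one>\<^bsub>R\<^esub> \<one>\<^bsub>R\<^esub>)"
begin

lemmas a_simps = linear_mapsD[OF algebra_homsD(1)[OF a]] algebra_homsD(2,3)[OF a]

definition L where "L = tensor_lift K U (\<lambda>r s. a r \<otimes>\<^bsub>U\<^esub> q \<otimes>\<^bsub>U\<^esub> a s)"

lemma L_linear: "L \<in> linear_maps K T U"
  and L_pure: "\<lbrakk>r \<in> carrier R; s \<in> carrier R\<rbrakk> \<Longrightarrow> L (pt r s) = a r \<otimes>\<^bsub>U\<^esub> q \<otimes>\<^bsub>U\<^esub> a s"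
proof -
  have bil: "(\<lambda>r s. a r \<otimes>\<^bsub>U\<^esub> q \<otimes>\<^bsub>U\<^esub> a s) \<in> bilinear_maps K R R U"
    using q by (intro bilinear_mapsI linear_mapsI)
      (simp_all add: a_simps U.l_distr U.r_distr U.smult_mult_left U.smult_mult_right)
  show "L \<in> linear_maps K T U"
    unfolding L_def by (rule TT.tensor_lift_linear[OF U.module_K bil])
  show "\<lbrakk>r \<in> carrier R; s \<in> carrier R\<rbrakk> \<Longrightarrow> L (pt r s) = a r \<otimes>\<^bsub>U\<^esub> q \<otimes>\<^bsub>U\<^esub> a s"
    unfolding L_def by (rule TT.tensor_lift_pure[OF U.module_K bil])
qed

lemmas L_simps = linear_mapsD[OF L_linear] linear_map_zero[OF TT.module_T U.module_K L_linear] L_pure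

definition g where "g = (\<lambda>(r, X). a r \<oplus>\<^bsub>U\<^esub> L X)"

lemma g_linear: "g \<in> linear_maps K S U"
  by (rule linear_mapsI) (auto simp: g_def sum_algebra_simps a_simps L_simps U.a_ac U.smult_r_distr)

text \<open>On a pure tensor, h turns r q s into the product (r, 0)(0, 1 tensor 1)(s, 0), which is
  (0, r tensor s).\<close>

lemma h_L: "X \<in> carrier T \<Longrightarrow> h (L X) = (\<zero>\<^bsub>R\<^esub>, X)"
proof (induction X rule: TT.tensor_induct)
  case zero
  then show ?case
    using linear_map_zero[OF U.module_K module_sum_algebra algebra_homsD(1)[OF h]]
    by (simp add: L_simps sum_algebra_simps)
next
  case (add X Y)
  then show ?case
    by (simp add: L_simps linear_mapsD(2)[OF algebra_homsD(1)[OF h]] sum_algebra_simps)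
next
  case (pure r s)
  then show ?case
    using q by (simp add: L_simps a_simps algebra_homsD(3)[OF h] ha hq sum_algebra_simps lmult_simps rmult_simps tmult_simps TT.pure_tensor_simps(1))
qed

lemma h_g: "x \<in> carrier S \<Longrightarrow> h (g x) = x"
  by (auto simp: g_def sum_algebra_simps linear_mapsD(2)[OF algebra_homsD(1)[OF h]] a_simps L_simps ha h_L)

lemma a_L: "\<lbrakk>X \<in> carrier T; r \<in> carrier R\<rbrakk> \<Longrightarrow> a r \<otimes>\<^bsub>U\<^esub> L X = L (lm r X)"
  by (induction X rule: TT.tensor_induct) (simp_all add: q L_simps a_simps lmult_simps U.r_distr U.m_assoc)

text \<open>The rewriting step: q r q s = P(r) q s + q P'(r) s trades two occurrences of q for one,
  and its right-hand side is L of (1 tensor 1)(r tensor s).\<close>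

lemma q_L: "X \<in> carrier T \<Longrightarrow> q \<otimes>\<^bsub>U\<^esub> L X = L (tm (pt \<one>\<^bsub>R\<^esub> \<one>\<^bsub>R\<^esub>) X)"
proof (induction X rule: TT.tensor_induct)
  case (pure r s)
  have "q \<otimes>\<^bsub>U\<^esub> L (pt r s) = (q \<otimes>\<^bsub>U\<^esub> a r \<otimes>\<^bsub>U\<^esub> q) \<otimes>\<^bsub>U\<^esub> a s"
    using pure q by (simp add: L_simps a_simps U.m_assoc)
  also have "\<dots> = L (tm (pt \<one>\<^bsub>R\<^esub> \<one>\<^bsub>R\<^esub>) (pt r s))"
    unfolding qaq[OF pure(1)]
    using pure q by (simp add: L_simps a_simps U.m_assoc U.l_distr tmult_simps P_closed P_tilde_simps TT.pure_tensor_simps(1))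
  finally show ?case .
qed (use q in \<open>simp_all add: L_simps tmult_simps TT.pure_tensor_simps(1) U.r_distr\<close>)

lemma g_surj: "g ` carrier S = carrier U"
proof
  interpret S: assoc_algebra K S by (rule assoc_algebra_sum_algebra)
  show "g ` carrier S \<subseteq> carrier U"
    using linear_mapsD(1)[OF g_linear] by auto
  have img: "a r \<oplus>\<^bsub>U\<^esub> L X \<in> g ` carrier S" if "r \<in> carrier R" "X \<in> carrier T" for r X
    using that by (auto intro!: image_eqI[of _ g "(r, X)"] simp: g_def sum_algebra_simps)
  note G = linear_mapsD(2,3)[OF g_linear, symmetric]
    linear_map_uminus[OF S.module_K U.module_K g_linear, symmetric]
  show "carrier U \<subseteq> g ` carrier S"
  proof (rule generated)
    show "submodule (g ` carrier S) K U"
      using linear_mapsD(1)[OF g_linear]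
      by (intro U.submoduleI)
        (auto simp: G linear_map_zero[OF S.module_K U.module_K g_linear, symmetric])
    show "\<one>\<^bsub>U\<^esub> \<in> g ` carrier S"
      using img[of "\<one>\<^bsub>R\<^esub>" "\<zero>\<^bsub>T\<^esub>"] by (simp add: a_simps L_simps)
    fix v assume "v \<in> g ` carrier S"
    then obtain s X where v: "s \<in> carrier R" "X \<in> carrier T" "v = a s \<oplus>\<^bsub>U\<^esub> L X"
      by (auto simp: g_def sum_algebra_simps)
    show "a r \<otimes>\<^bsub>U\<^esub> v \<in> g ` carrier S" if "r \<in> carrier R" for r
      using img[of "r \<otimes>\<^bsub>R\<^esub> s" "lm r X"] v that by (simp add: a_simps L_simps U.r_distr a_L lmult_simps)
    \<comment> \<open>q a(s) is L(1 tensor s), so the component in R is zero; a(0) is written out to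
      match the form of \<open>img\<close>.\<close>
    have "q \<otimes>\<^bsub>U\<^esub> v = a \<zero>\<^bsub>R\<^esub> \<oplus>\<^bsub>U\<^esub> L (pt \<one>\<^bsub>R\<^esub> s \<oplus>\<^bsub>T\<^esub> tm (pt \<one>\<^bsub>R\<^esub> \<one>\<^bsub>R\<^esub>) X)"
      using v q linear_map_zero[OF module_K U.module_K algebra_homsD(1)[OF a]]
      by (simp add: a_simps L_simps U.r_distr q_L tmult_simps TT.pure_tensor_simps(1))
    then show "q \<otimes>\<^bsub>U\<^esub> v \<in> g ` carrier S"
      using img[of "\<zero>\<^bsub>R\<^esub>" "pt \<one>\<^bsub>R\<^esub> s \<oplus>\<^bsub>T\<^esub> tm (pt \<one>\<^bsub>R\<^esub> \<one>\<^bsub>R\<^esub>) X"] v by (simp add: tmult_simps TT.pure_tensor_simps(1))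
  qed
qed

text \<open>Every element of U is some g x and h (g x) = x, so h is injective; the same equation
  shows that h is onto.\<close>

lemma h_iso: "h \<in> algebra_iso K U S"
proof (rule algebra_isoI[OF h])
  show "inj_on h (carrier U)"
    unfolding g_surj[symmetric] by (rule inj_onI) (auto simp: h_g)
  show "h ` carrier U = carrier S"
  proof
    show "h ` carrier U \<subseteq> carrier S"
      using linear_mapsD(1)[OF algebra_homsD(1)[OF h]] by blast
    show "carrier S \<subseteq> h ` carrier U"
    proof
      fix x assume "x \<in> carrier S"
      then show "x \<in> h ` carrier U"
        by (intro image_eqI[of _ _ "g x"]) (simp_all add: h_g linear_mapsD(1)[OF g_linear])
    qed
  qed
qed

end

section \<open>The free product, the ring of Rota-Baxter operators and its generators\<close>

context rota_baxter_algebra begin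

sublocale UPA: up_alg K
  by (intro up_alg.intro R.is_cring)

sublocale FR: free_alg K "carrier R <+> carrier (UP K)"
  by (intro free_alg.intro R.is_cring)

abbreviation "FA \<equiv> free_algebra2 K R (UP K)"
abbreviation "I \<equiv> free_product_ideal K R (UP K)"
abbreviation "FP \<equiv> free_product K R (UP K)"
abbreviation "\<iota> \<equiv> free_product_inl K R (UP K)"
abbreviation "\<kappa> \<equiv> free_product_inr K R (UP K)"

interpretation FA: assoc_algebra K FA
  by (rule FR.assoc_algebra_free_algebra)

lemma letters_closed:
  "r \<in> carrier R \<Longrightarrow> basis_vec K [Inl r] \<in> carrier FA"
  "p \<in> carrier (UP K) \<Longrightarrow> basis_vec K [Inr p] \<in> carrier FA"
  by (auto intro!: FR.FA.basis_vec_closed)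

lemma assoc_algebra_R: "assoc_algebra K R"
  by (rule assoc_algebra_axioms)

lemma I_ideal: "ideal I FA"
  and hom_relations_in_I: "hom_relations K R FA (\<lambda>a. basis_vec K [Inl a]) \<subseteq> I"
    "hom_relations K (UP K) FA (\<lambda>b. basis_vec K [Inr b]) \<subseteq> I"
proof -
  have sub: "hom_relations K R FA (\<lambda>a. basis_vec K [Inl a]) \<union>
      hom_relations K (UP K) FA (\<lambda>b. basis_vec K [Inr b]) \<subseteq> carrier FA"
    using FA.hom_relations_closed assoc_algebra_R UPA.UP_assoc_algebra letters_closed by (metis Un_least)
  show "ideal I FA"
    unfolding free_product_ideal_def by (rule FA.genideal_ideal[OF sub])
  show "hom_relations K R FA (\<lambda>a. basis_vec K [Inl a]) \<subseteq> I"
    "hom_relations K (UP K) FA (\<lambda>b. basis_vec K [Inr b]) \<subseteq> I"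
    using FA.genideal_self[OF sub] unfolding free_product_ideal_def by auto
qed

lemma assoc_algebra_free_product: "assoc_algebra K FP"
  unfolding free_product_def by (rule FA.assoc_algebra_quotient[OF I_ideal])

interpretation FP: assoc_algebra K FP
  by (rule assoc_algebra_free_product)

lemma inl_hom: "\<iota> \<in> algebra_homs K R FP"
  unfolding free_product_inl_def[abs_def] free_product_def
  by (rule FA.hom_relations_quotient[OF assoc_algebra_R letters_closed(1) I_ideal hom_relations_in_I(1)])

lemma inr_hom: "\<kappa> \<in> algebra_homs K (UP K) FP"
  unfolding free_product_inr_def[abs_def] free_product_def
  by (rule FA.hom_relations_quotient[OF UPA.UP_assoc_algebra letters_closed(2) I_ideal hom_relations_in_I(2)])

text \<open>Universal property of the coproduct: letters from the two algebras are evaluated by f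
  and by g, and the resulting map on words kills the relations because f and g are
  homomorphisms.\<close>

lemma free_product_lift:
  assumes B: "assoc_algebra K B" and f: "f \<in> algebra_homs K R B" and g: "g \<in> algebra_homs K (UP K) B"
  obtains h where "h \<in> algebra_homs K FP B" "\<And>r. r \<in> carrier R \<Longrightarrow> h (\<iota> r) = f r"
    "\<And>p. p \<in> carrier (UP K) \<Longrightarrow> h (\<kappa> p) = g p"
proof -
  let ?e = "free_algebra_lift K B (case_sum f g)"
  have \<phi>: "case_sum f g x \<in> carrier B" if "x \<in> carrier R <+> carrier (UP K)" for x
    using that linear_mapsD(1)[OF algebra_homsD(1)[OF f]] linear_mapsD(1)[OF algebra_homsD(1)[OF g]]
    by auto
  note e = FR.free_algebra_lift_hom[OF B \<phi>] and e_gen = FR.free_algebra_lift_generator[OF B \<phi>]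
  have "I \<subseteq> {x \<in> carrier FA. ?e x = \<zero>\<^bsub>B\<^esub>}"
    unfolding free_product_ideal_def
    using FA.hom_relations_kernel[OF assoc_algebra_R B letters_closed(1) e f]
      FA.hom_relations_kernel[OF UPA.UP_assoc_algebra B letters_closed(2) e g]
    by (intro FA.genideal_minimal FA.algebra_hom_kernel_ideal[OF B e] Un_least) (simp_all add: e_gen InlI InrI)
  then have vanish: "?e x = \<zero>\<^bsub>B\<^esub>" if "x \<in> I" for x
    using that by auto
  show thesis
  proof
    show "(\<lambda>X. the_elem (?e ` X)) \<in> algebra_homs K FP B"
      unfolding free_product_def by (rule FA.quotient_induced_algebra_hom[OF I_ideal B e vanish])
    note ind = FR.FA.the_elem_coset[OF FA.ideal_submodule[OF I_ideal] assoc_algebra.module_K[OF B] algebra_homsD(1)[OF e] vanish]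
    show "the_elem (?e ` \<iota> r) = f r" if "r \<in> carrier R" for r
      using that by (simp add: free_product_inl_def ind letters_closed e_gen InlI)
    show "the_elem (?e ` \<kappa> p) = g p" if "p \<in> carrier (UP K)" for p
      using that by (simp add: free_product_inr_def ind letters_closed e_gen InrI)
  qed
qed

definition "Q = \<kappa> (monom (UP K) \<one> 1)"

abbreviation "J \<equiv> Idl\<^bsub>FP\<^esub> (rb_relations K R P lam)"
abbreviation "U \<equiv> U_RB K R P lam"

definition rb_rel where
  "rb_rel r = Q \<otimes>\<^bsub>FP\<^esub> \<iota> r \<otimes>\<^bsub>FP\<^esub> Q \<ominus>\<^bsub>FP\<^esub> \<iota> (P r) \<otimes>\<^bsub>FP\<^esub> Q \<oplus>\<^bsub>FP\<^esub> Q \<otimes>\<^bsub>FP\<^esub> \<iota> (P r)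
           \<oplus>\<^bsub>FP\<^esub> lam \<odot>\<^bsub>FP\<^esub> (Q \<otimes>\<^bsub>FP\<^esub> \<iota> r)"

lemma Q_closed: "Q \<in> carrier FP"
  unfolding Q_def by (rule linear_mapsD(1)[OF algebra_homsD(1)[OF inr_hom]]) simp

lemmas inl = linear_mapsD[OF algebra_homsD(1)[OF inl_hom]]

lemma rb_relations_eq: "rb_relations K R P lam = rb_rel ` carrier R"
  unfolding rb_relations_def rb_rel_def Q_def Let_def by blast

lemma rb_rel_closed: "r \<in> carrier R \<Longrightarrow> rb_rel r \<in> carrier FP"
  by (simp add: rb_rel_def Q_closed inl P_closed weight_closed)

lemma rb_relations_closed: "rb_relations K R P lam \<subseteq> carrier FP"
  by (auto simp: rb_relations_eq rb_rel_closed)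

lemma J_ideal: "ideal J FP"
  by (rule FP.genideal_ideal[OF rb_relations_closed])

lemma assoc_algebra_U: "assoc_algebra K U"
  unfolding U_RB_def by (rule FP.assoc_algebra_quotient[OF J_ideal])

interpretation U: assoc_algebra K U
  by (rule assoc_algebra_U)

abbreviation "\<pi> \<equiv> (\<lambda>x. J +>\<^bsub>FP\<^esub> x)"

lemma \<pi>_hom: "\<pi> \<in> algebra_homs K FP U"
  unfolding U_RB_def by (rule FP.quotient_algebra_hom[OF J_ideal])

lemma algebra_hom_rb_rel:
  assumes B: "assoc_algebra K B" and f: "f \<in> algebra_homs K FP B" and r: "r \<in> carrier R"
  shows "f (rb_rel r) = f Q \<otimes>\<^bsub>B\<^esub> f (\<iota> r) \<otimes>\<^bsub>B\<^esub> f Q \<ominus>\<^bsub>B\<^esub> f (\<iota> (P r)) \<otimes>\<^bsub>B\<^esub> f Q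
    \<oplus>\<^bsub>B\<^esub> f Q \<otimes>\<^bsub>B\<^esub> f (\<iota> (P r)) \<oplus>\<^bsub>B\<^esub> lam \<odot>\<^bsub>B\<^esub> (f Q \<otimes>\<^bsub>B\<^esub> f (\<iota> r))"
  using r Q_closed
  by (simp add: rb_rel_def inl P_closed weight_closed linear_mapsD(2,3)[OF algebra_homsD(1)[OF f]] algebra_homsD(3)[OF f]
      linear_map_minus[OF FP.module_K assoc_algebra.module_K[OF B] algebra_homsD(1)[OF f]])

lemma U_relation:
  assumes r: "r \<in> carrier R"
  shows "\<pi> Q \<otimes>\<^bsub>U\<^esub> \<pi> (\<iota> r) \<otimes>\<^bsub>U\<^esub> \<pi> Q = \<pi> (\<iota> (P r)) \<otimes>\<^bsub>U\<^esub> \<pi> Q \<oplus>\<^bsub>U\<^esub> \<pi> Q \<otimes>\<^bsub>U\<^esub> \<pi> (\<iota> (P' r))"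
proof -
  have "rb_rel r \<in> J"
    using FP.genideal_self[OF rb_relations_closed] r by (auto simp: rb_relations_eq)
  then have "\<pi> (rb_rel r) = \<zero>\<^bsub>U\<^esub>"
    using FP.quotient_zero_iff[OF FP.ideal_submodule[OF J_ideal] rb_rel_closed[OF r]]
    by (simp add: U_RB_def)
  then show ?thesis
    unfolding algebra_hom_rb_rel[OF assoc_algebra_U \<pi>_hom r]
    using rb_relation_iff[OF assoc_algebra_U algebra_homs_compose[OF inl_hom \<pi>_hom] _ r, of "\<pi> Q"]
      linear_mapsD(1)[OF algebra_homsD(1)[OF \<pi>_hom]] Q_closed
    by simp
qed

text \<open>Letters are elements of R or arbitrary polynomials in Q, whereas closure is given only
  for R and Q. It is extended to powers of Q, to all of k[Q], to words built from 1 by prefixing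
  letters, and finally to linear combinations.\<close>

lemma U_generated:
  assumes V: "submodule V K U" and one: "\<one>\<^bsub>U\<^esub> \<in> V"
    and inl: "\<And>r v. \<lbrakk>r \<in> carrier R; v \<in> V\<rbrakk> \<Longrightarrow> \<pi> (\<iota> r) \<otimes>\<^bsub>U\<^esub> v \<in> V"
    and Q: "\<And>v. v \<in> V \<Longrightarrow> \<pi> Q \<otimes>\<^bsub>U\<^esub> v \<in> V"
  shows "carrier U \<subseteq> V"
proof -
  \<comment> \<open>Zero starts the additive inductions below.\<close>
  have "\<zero>\<^bsub>U\<^esub> \<in> V"
    using subgroup.one_closed[OF submodule.axioms(1)[OF V]] by simp
  note V = U.submoduleE[OF V] this
  have VU: "v \<in> V \<Longrightarrow> v \<in> carrier U" for v using V(1) by auto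
  let ?b = "\<lambda>p. \<pi> (\<kappa> p)"
  have b: "?b \<in> algebra_homs K (UP K) U"
    by (rule algebra_homs_compose[OF inr_hom \<pi>_hom])
  note b = linear_mapsD[OF algebra_homsD(1)[OF b]] algebra_homsD(2,3)[OF b]
    linear_map_zero[OF UPA.UPF.finsupp_is_module U.module_K algebra_homsD(1)[OF b]]
  \<comment> \<open>Kept general in v, as letters are later prefixed to arbitrary elements of V; the
    step uses Q^(i+1) = Q Q^i.\<close>
  have power: "?b (basis_vec K i) \<otimes>\<^bsub>U\<^esub> v \<in> V" if v: "v \<in> V" for i v
  proof (induction i)
    case 0
    then show ?case using v VU by (simp add: b UPA.UP_one_basis[symmetric])
  next
    case (Suc i)
    have "basis_vec K (Suc i) = monom (UP K) \<one> 1 \<otimes>\<^bsub>UP K\<^esub> basis_vec K i"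
      using UPA.UP_mult_basis[of 1 i] by (simp add: UPA.basis_vec_monom)
    then show ?case
      using Q[OF Suc.IH] v VU by (simp add: Q_def b UPA.UPF.basis_vec_closed U.m_assoc)
  qed
  have inr: "?b p \<otimes>\<^bsub>U\<^esub> v \<in> V" if "p \<in> carrier (UP K)" "v \<in> V" for p v
    using that(1)
  proof (induction p rule: UPA.UPF.finsupp_induct)
    case zero
    then show ?case using that VU V by (simp add: b)
  next
    case (add f g)
    then show ?case using that VU V by (simp add: b U.l_distr)
  next
    case (basis c i)
    then show ?case
      using that(2) VU V power by (simp add: b UPA.UPF.basis_vec_closed U.smult_mult_left)
  qed
  let ?p = "\<lambda>f. \<pi> (I +>\<^bsub>FA\<^esub> f)"
  have p: "?p \<in> algebra_homs K FA U"
    using algebra_homs_compose[OF _ \<pi>_hom] FA.quotient_algebra_hom[OF I_ideal]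
    unfolding free_product_def by blast
  note p = linear_mapsD[OF algebra_homsD(1)[OF p]] algebra_homsD(2,3)[OF p]
    linear_map_zero[OF FA.module_K U.module_K algebra_homsD(1)[OF p]]
  have letter: "?p (basis_vec K [x]) \<otimes>\<^bsub>U\<^esub> v \<in> V" if "x \<in> carrier R <+> carrier (UP K)" "v \<in> V" for x v
    using that inl inr by (auto simp: free_product_inl_def free_product_inr_def)
  have word: "?p (basis_vec K w) \<in> V" if "w \<in> lists (carrier R <+> carrier (UP K))" for w
    using that
  proof (induction w)
    case Nil
    then show ?case using one by (simp add: p FR.free_algebra_one[symmetric])
  next
    case (Cons x w)
    have "basis_vec K (x # w) = basis_vec K [x] \<otimes>\<^bsub>FA\<^esub> basis_vec K w"
      by (simp add: FR.free_algebra_mult_basis)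
    then show ?case
      using letter[OF Cons.hyps(1) Cons.IH] Cons.hyps by (simp add: p FR.FA.basis_vec_closed)
  qed
  have "?p f \<in> V" if "f \<in> carrier FA" for f
    using that by (induction f rule: FR.FA.finsupp_induct) (simp_all add: p V word FR.FA.basis_vec_closed)
  then show ?thesis
    by (auto simp: U_RB_def free_product_def quotient_module_simps(1))
qed

lemma U_iso: "\<exists>h. h \<in> algebra_iso K U S"
proof -
  note SA = assoc_algebra_sum_algebra
  let ?q = "(\<zero>\<^bsub>R\<^esub>, pt \<one>\<^bsub>R\<^esub> \<one>\<^bsub>R\<^esub>)"
  have q: "?q \<in> carrier S" by (simp add: sum_algebra_simps TT.pure_tensor_simps(1))
  \<comment> \<open>The inclusion of R and evaluation of polynomials at 1 tensor 1 combine to a map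
    on the free product.\<close>
  obtain f where f: "f \<in> algebra_homs K FP S" "\<And>r. r \<in> carrier R \<Longrightarrow> f (\<iota> r) = (r, \<zero>\<^bsub>T\<^esub>)"
    "\<And>p. p \<in> carrier (UP K) \<Longrightarrow> f (\<kappa> p) = linear_ext K S (\<lambda>i::nat. ?q [^]\<^bsub>S\<^esub> i) p"
    using free_product_lift[OF SA sum_algebra_inl UPA.UP_lift_hom[OF SA q]] by blast
  have fQ: "f Q = ?q"
    using f(3) UPA.UP_lift_X[OF SA q] by (simp add: Q_def del: One_nat_def)
  \<comment> \<open>The two-term rule for 1 tensor 1, read backwards through
    \<open>rb_relation_iff\<close>, is the vanishing of each defining relation.\<close>
  have "rb_relations K R P lam \<subseteq> {x \<in> carrier FP. f x = \<zero>\<^bsub>S\<^esub>}"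
    using rb_relation_iff[OF SA sum_algebra_inl q] sum_algebra_q_relation
    by (auto simp: rb_relations_eq rb_rel_closed algebra_hom_rb_rel[OF SA f(1)] f(2) fQ P_closed)
  then have "J \<subseteq> {x \<in> carrier FP. f x = \<zero>\<^bsub>S\<^esub>}"
    by (intro FP.genideal_minimal FP.algebra_hom_kernel_ideal[OF SA f(1)])
  then have vanish: "f x = \<zero>\<^bsub>S\<^esub>" if "x \<in> J" for x
    using that by auto
  let ?h = "\<lambda>X. the_elem (f ` X)"
  have h: "?h \<in> algebra_homs K U S"
    unfolding U_RB_def by (rule FP.quotient_induced_algebra_hom[OF J_ideal SA f(1) vanish])
  have h\<pi>: "?h (\<pi> x) = f x" if "x \<in> carrier FP" for x
    by (rule FP.the_elem_coset[OF FP.ideal_submodule[OF J_ideal] assoc_algebra.module_K[OF SA]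
          algebra_homsD(1)[OF f(1)] vanish that])
  have "rota_baxter_presentation K R P lam U (\<lambda>r. \<pi> (\<iota> r)) (\<pi> Q) ?h"
  proof (intro rota_baxter_presentation.intro rota_baxter_algebra_axioms assoc_algebra_U
      rota_baxter_presentation_axioms.intro)
    show "(\<lambda>r. \<pi> (\<iota> r)) \<in> algebra_homs K R U"
      by (rule algebra_homs_compose[OF inl_hom \<pi>_hom])
    show "\<pi> Q \<in> carrier U"
      by (rule linear_mapsD(1)[OF algebra_homsD(1)[OF \<pi>_hom] Q_closed])
    show "\<pi> Q \<otimes>\<^bsub>U\<^esub> \<pi> (\<iota> r) \<otimes>\<^bsub>U\<^esub> \<pi> Q = \<pi> (\<iota> (P r)) \<otimes>\<^bsub>U\<^esub> \<pi> Q \<oplus>\<^bsub>U\<^esub> \<pi> Q \<otimes>\<^bsub>U\<^esub> \<pi> (\<iota> (P' r))"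
      if "r \<in> carrier R" for r
      using that by (rule U_relation)
    show "?h (\<pi> (\<iota> r)) = (r, \<zero>\<^bsub>T\<^esub>)" if "r \<in> carrier R" for r
      using that by (simp add: h\<pi> inl f(2))
    show "?h (\<pi> Q) = ?q"
      by (simp add: h\<pi> Q_closed fQ)
  qed (use U_generated h in blast)+
  then have "?h \<in> algebra_iso K U S"
    by (rule rota_baxter_presentation.h_iso)
  then show ?thesis by blast
qed

end

theorem theorem4p3:
  fixes K :: "('k, 'u) ring_scheme"
    and R :: "('k, 'r, 'v) module_scheme"
    and P :: "'r \<Rightarrow> 'r" and lam :: 'k
  assumes "rota_baxter_algebra K R P lam"
  shows "algebras_isomorphic K (U_RB K R P lam) (rb_sum_algebra K R P lam)"
proof -
  interpret rota_baxter_algebra K R P lam by fact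
  show ?thesis
    unfolding algebras_isomorphic_def
    using assoc_algebra_U assoc_algebra_sum_algebra U_iso by blast
qed

end
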